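(* Let $s\ge 1$. A function $n\mapsto r(n)$ from $\mathbb Z$ into $\mathbb H^{s\times s}$ is positive definite if and only if there exists a unique $q$-positive measure $\nu$ on $[0,2\pi]$ such that $$r(n)=\int_0^{2\pi}e^{int}\,d\nu(t),\qquad n\in\mathbb Z.$$
   Context: $\mathbb H$ denotes the quaternions with imaginary units $i,j,k$, and $\mathbb C=\mathbb R+i\mathbb R\subset\mathbb H$. Every $P\in\mathbb H^{s\times s}$ is uniquely $P=P_1+P_2j$ with $P_1,P_2\in\mathbb C^{s\times s}$. A function $r:\mathbb Z\to\mathbb H^{s\times s}$ is positive definite if for every $N\ge 0$ the block Toeplitz matrix $\mathbb T_N=(r(\ell-m))_{m,\ell=0}^{N}$ (block row index $m$, block column index $\ell$) is Hermitian positive semidefinite. Measures on $[0,2\pi]$ are finite Borel measures with the endpoints $0$ and $2\pi$ identified (i.e. measures on the circle $\mathbb R/2\pi\mathbb Z$), and $t\mapsto 2\pi-t$ is the reflection $t\mapsto -t$ of the circle. A $\mathbb C^{m\times m}$-valued measure is positive if its value on each Borel set is a Hermitian positive semidefinite matrix. For a matrix-valued measure $\sigma$, the measures $\bar\sigma$, $\sigma^T$, $\sigma^*$ are obtained by taking the entrywise conjugate, transpose, and conjugate transpose of the value on each Borel set. An $\mathbb H^{s\times s}$-valued measure $\nu$ is written uniquely as $\nu=\nu_1+\nu_2j$ with $\nu_1,\nu_2$ being $\mathbb C^{s\times s}$-valued measures, and $\int e^{int}d\nu(t)=\int e^{int}d\nu_1(t)+\big(\int e^{int}d\nu_2(t)\big)j$.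 The measure $\nu$ is called $q$-positive if the $\mathbb C^{2s\times 2s}$-valued measure $$\mu=\begin{pmatrix}\nu_1&\nu_2\\ \nu_2^*&\nu_3\end{pmatrix},\qquad d\nu_3(t)=d\bar\nu_1(2\pi-t),\ t\in[0,2\pi),$$ is positive and, in addition, $d\nu_2(t)=-d\nu_2(2\pi-t)^T$ for $t\in[0,2\pi)$. *)

theory Defs
  imports "HOL-Analysis.Analysis"
begin

section \<open>Quaternions\<close>

datatype quat = Quat (q1: real) (qi: real) (qj: real) (qk: real)

lemma quat_eq_iff: "x = y \<longleftrightarrow> q1 x = q1 y \<and> qi x = qi y \<and> qj x = qj y \<and> qk x = qk y"
  by (auto intro: quat.expand)

instantiation quat :: ring_1
begin

definition zero_quat :: quat where "0 = Quat 0 0 0 0"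
definition one_quat :: quat where "1 = Quat 1 0 0 0"
definition plus_quat :: "quat \<Rightarrow> quat \<Rightarrow> quat" where
  "x + y = Quat (q1 x + q1 y) (qi x + qi y) (qj x + qj y) (qk x + qk y)"
definition minus_quat :: "quat \<Rightarrow> quat \<Rightarrow> quat" where
  "x - y = Quat (q1 x - q1 y) (qi x - qi y) (qj x - qj y) (qk x - qk y)"
definition uminus_quat :: "quat \<Rightarrow> quat" where
  "- x = Quat (- q1 x) (- qi x) (- qj x) (- qk x)"
definition times_quat :: "quat \<Rightarrow> quat \<Rightarrow> quat" where
  "x * y = Quat
    (q1 x * q1 y - qi x * qi y - qj x * qj y - qk x * qk y)
    (q1 x * qi y + qi x * q1 y + qj x * qk y - qk x * qj y)
    (q1 x * qj y - qi x * qk y + qj x * q1 y + qk x * qi y)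
    (q1 x * qk y + qi x * qj y - qj x * qi y + qk x * q1 y)"

instance
  by standard
    (simp_all add: zero_quat_def one_quat_def plus_quat_def minus_quat_def uminus_quat_def
      times_quat_def quat_eq_iff algebra_simps)

end

instantiation quat :: real_algebra_1
begin

definition scaleR_quat :: "real \<Rightarrow> quat \<Rightarrow> quat" where
  "scaleR c x = Quat (c * q1 x) (c * qi x) (c * qj x) (c * qk x)"

instance
  by standard (simp_all add: scaleR_quat_def plus_quat_def times_quat_def zero_quat_def
      one_quat_def quat_eq_iff algebra_simps)

end

instantiation quat :: real_normed_vector
begin

definition norm_quat :: "quat \<Rightarrow> real" where
  "norm_quat x = sqrt ((q1 x)\<^sup>2 + (qi x)\<^sup>2 + (qj x)\<^sup>2 + (qk x)\<^sup>2)"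
definition sgn_quat :: "quat \<Rightarrow> quat" where
  "sgn_quat x = x /\<^sub>R norm x"
definition dist_quat :: "quat \<Rightarrow> quat \<Rightarrow> real" where
  "dist_quat x y = norm (x - y)"
definition uniformity_quat :: "(quat \<times> quat) filter" where
  "uniformity_quat = (INF e\<in>{0<..}. principal {(x, y). dist x y < e})"
definition open_quat :: "quat set \<Rightarrow> bool" where
  "open_quat U \<longleftrightarrow> (\<forall>x\<in>U. eventually (\<lambda>(x', y). x' = x \<longrightarrow> y \<in> U) uniformity)"

instance
proof
  have norm_pair: "norm x = norm (Complex (q1 x) (qi x), Complex (qj x) (qk x))" for x :: quat
    by (simp add: norm_quat_def norm_Pair cmod_def)
  fix x y :: quat and c :: real
  show "norm x = 0 \<longleftrightarrow> x = 0"
    unfolding norm_pair norm_eq_zero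
    by (simp add: quat_eq_iff zero_quat_def complex_eq_iff zero_prod_def)
  show "norm (x + y) \<le> norm x + norm y"
    unfolding norm_pair
    using norm_triangle_ineq[of "(Complex (q1 x) (qi x), Complex (qj x) (qk x))"
        "(Complex (q1 y) (qi y), Complex (qj y) (qk y))"]
    by (simp add: plus_quat_def complex_add)
  show "norm (c *\<^sub>R x) = \<bar>c\<bar> * norm x"
    by (simp add: norm_quat_def scaleR_quat_def power_mult_distrib flip: distrib_left)
      (simp add: real_sqrt_mult)
qed (simp_all add: scaleR_quat_def sgn_quat_def dist_quat_def
      uniformity_quat_def open_quat_def plus_quat_def quat_eq_iff algebra_simps)

end

definition quat_i :: quat where "quat_i = Quat 0 1 0 0"
definition quat_j :: quat where "quat_j = Quat 0 0 1 0"
definition quat_k :: quat where "quat_k = Quat 0 0 0 1"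

lemma quat_units:
  "quat_i * quat_i = -1" "quat_j * quat_j = -1" "quat_k * quat_k = -1"
  "quat_i * quat_j = quat_k" "quat_j * quat_k = quat_i" "quat_k * quat_i = quat_j"
  by (simp_all add: quat_i_def quat_j_def quat_k_def times_quat_def one_quat_def uminus_quat_def)

definition qcnj :: "quat \<Rightarrow> quat" where
  "qcnj x = Quat (q1 x) (- qi x) (- qj x) (- qk x)"

definition quat_of_complex :: "complex \<Rightarrow> quat" where
  "quat_of_complex z = Quat (Re z) (Im z) 0 0"

text \<open>The complex components of \<open>x = z + w j\<close>.\<close>

definition cpart1 :: "quat \<Rightarrow> complex" where "cpart1 x = Complex (q1 x) (qi x)"
definition cpart2 :: "quat \<Rightarrow> complex" where "cpart2 x = Complex (qj x) (qk x)"

lemma quat_cparts_iff: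
  "x = quat_of_complex z + quat_of_complex w * quat_j \<longleftrightarrow> z = cpart1 x \<and> w = cpart2 x"
  by (auto simp: quat_of_complex_def cpart1_def cpart2_def quat_j_def times_quat_def
      plus_quat_def quat_eq_iff complex_eq_iff)


section \<open>Matrices and positive semidefiniteness\<close>

definition mat_cpart1 :: "quat^'s^'s \<Rightarrow> complex^'s^'s" where
  "mat_cpart1 P = (\<chi> a b. cpart1 (P $ a $ b))"

definition mat_cpart2 :: "quat^'s^'s \<Rightarrow> complex^'s^'s" where
  "mat_cpart2 P = (\<chi> a b. cpart2 (P $ a $ b))"

definition mat_cnj :: "complex^'s^'s \<Rightarrow> complex^'s^'s" where
  "mat_cnj P = (\<chi> a b. cnj (P $ a $ b))"

definition mat_adj :: "complex^'s^'s \<Rightarrow> complex^'s^'s" where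
  "mat_adj P = transpose (mat_cnj P)"

definition block_matrix ::
  "complex^'s^'s \<Rightarrow> complex^'s^'s \<Rightarrow> complex^'s^'s \<Rightarrow> complex^'s^'s \<Rightarrow> complex^('s + 's)^('s + 's)"
  where "block_matrix A B C D = (\<chi> p q. case (p, q) of
      (Inl a, Inl b) \<Rightarrow> A $ a $ b
    | (Inl a, Inr b) \<Rightarrow> B $ a $ b
    | (Inr a, Inl b) \<Rightarrow> C $ a $ b
    | (Inr a, Inr b) \<Rightarrow> D $ a $ b)"

text \<open>Hermitian positive semidefiniteness of a matrix over a finite index set, relative to the
  conjugation \<open>cj\<close> of the scalars. The Hermitian condition is stated separately; the order of the
  factors in the quadratic form matters over the quaternions.\<close>

definition hermitian_psd ::
  "('a::real_algebra_1 \<Rightarrow> 'a) \<Rightarrow> 'i set \<Rightarrow> ('i \<Rightarrow> 'i \<Rightarrow> 'a) \<Rightarrow> bool" where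
  "hermitian_psd cj I A \<longleftrightarrow>
     (\<forall>p\<in>I. \<forall>q\<in>I. A q p = cj (A p q)) \<and>
     (\<forall>v. (\<Sum>p\<in>I. \<Sum>q\<in>I. cj (v p) * A p q * v q) \<in> \<real>\<^sub>\<ge>\<^sub>0)"

text \<open>Rows of the block Toeplitz matrix are indexed by pairs of a block row \<open>m\<close> and a row \<open>a\<close>
  inside the block, and similarly for columns.\<close>

definition block_toeplitz :: "(int \<Rightarrow> 'a^'s^'s) \<Rightarrow> nat \<times> 's \<Rightarrow> nat \<times> 's \<Rightarrow> 'a" where
  "block_toeplitz r = (\<lambda>(m, a) (l, b). r (int l - int m) $ a $ b)"

definition positive_definite :: "(int \<Rightarrow> quat^'s^'s) \<Rightarrow> bool" where
  "positive_definite r \<longleftrightarrow> (\<forall>N. hermitian_psd qcnj ({0..N} \<times> UNIV) (block_toeplitz r))"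


section \<open>Vector-valued measures\<close>

text \<open>Countably additive set functions; as for \<^const>\<open>emeasure\<close>, the value on a non-measurable
  set is fixed to be \<open>0\<close>, so that equality of measures is equality of functions.\<close>

definition vector_measure :: "'x measure \<Rightarrow> ('x set \<Rightarrow> 'b::real_normed_vector) \<Rightarrow> bool" where
  "vector_measure M \<nu> \<longleftrightarrow>
     (\<forall>A. A \<notin> sets M \<longrightarrow> \<nu> A = 0) \<and>
     (\<forall>F :: nat \<Rightarrow> 'x set. range F \<subseteq> sets M \<longrightarrow> disjoint_family F \<longrightarrow>
        (\<lambda>n. \<nu> (F n)) sums \<nu> (\<Union>n. F n))"

text \<open>Integration against signed and complex measures, by Jordan decomposition.
  The negative part of \<open>\<sigma>\<close> is the positive part of \<open>- \<sigma>\<close>. Negative values are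
  truncated to \<open>0\<close> by \<^const>\<open>ennreal\<close>, which does not affect the supremum as \<open>B = {}\<close> is
  allowed.\<close>

definition positive_part :: "'x measure \<Rightarrow> ('x set \<Rightarrow> real) \<Rightarrow> 'x measure" where
  "positive_part M \<sigma> =
     measure_of (space M) (sets M) (\<lambda>A. SUP B\<in>{B \<in> sets M. B \<subseteq> A}. ennreal (\<sigma> B))"

definition signed_integral :: "'x measure \<Rightarrow> ('x set \<Rightarrow> real) \<Rightarrow> ('x \<Rightarrow> complex) \<Rightarrow> complex" where
  "signed_integral M \<sigma> f =
     (LINT x|positive_part M \<sigma>. f x) - (LINT x|positive_part M (\<lambda>A. - \<sigma> A). f x)"

definition complex_measure_integral ::
  "'x measure \<Rightarrow> ('x set \<Rightarrow> complex) \<Rightarrow> ('x \<Rightarrow> complex) \<Rightarrow> complex" where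
  "complex_measure_integral M \<kappa> f =
     signed_integral M (\<lambda>A. Re (\<kappa> A)) f + \<i> * signed_integral M (\<lambda>A. Im (\<kappa> A)) f"

lemma signed_integral_measure:
  assumes "finite_measure N" and "sets N = sets M"
  shows "signed_integral M (measure N) f = (LINT x|N. f x)"
proof -
  interpret finite_measure N by fact
  have sp: "space M = space N" using assms(2) by (metis sets_eq_imp_space_eq)
  have "(SUP B\<in>{B \<in> sets N. B \<subseteq> A}. ennreal (measure N B)) = emeasure N A" if "A \<in> sets N" for A
    using that by (intro antisym SUP_least SUP_upper2[of A])
      (auto simp: emeasure_eq_measure intro!: ennreal_leI finite_measure_mono)
  then have "positive_part M (measure N) = measure_of (space N) (sets N) (emeasure N)"
    unfolding positive_part_def assms(2)[symmetric] sp
    by (intro measure_of_eq) (auto simp: sets.space_closed sets.sigma_sets_eq)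
  then have pos: "positive_part M (measure N) = N"
    by (simp add: measure_of_of_measure)
  have "(SUP B\<in>{B \<in> sets M. B \<subseteq> A}. ennreal (- measure N B)) = 0" for A
    by (intro antisym SUP_least) (auto simp: ennreal_neg)
  then have "positive_part M (\<lambda>A. - measure N A) = measure_of (space M) (sets M) (\<lambda>_. 0)"
    unfolding positive_part_def by simp
  moreover have "AE x in measure_of (space M) (sets M) (\<lambda>_. 0). f x = 0"
    by (rule AE_I[where N = "space M"])
      (auto simp: sets.space_closed emeasure_sigma)
  ultimately have "(LINT x|positive_part M (\<lambda>A. - measure N A). f x) = 0"
    by (simp add: integral_eq_zero_AE)
  with pos show ?thesis
    unfolding signed_integral_def by simp
qed


section \<open>Matrix-valued measures on the circle\<close>

text \<open>The circle is represented by the fundamental domain \<open>[0, 2\<pi>)\<close>. The map \<open>t \<mapsto> 2\<pi> - t\<close> fixes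
  the point \<open>0\<close>, which is identified with \<open>2\<pi>\<close>.\<close>

definition circle :: "real measure" where
  "circle = restrict_space borel {0..<2 * pi}"

definition circle_reflect :: "real \<Rightarrow> real" where
  "circle_reflect t = (if t = 0 then 0 else 2 * pi - t)"

definition reflected :: "(real set \<Rightarrow> 'b::zero) \<Rightarrow> real set \<Rightarrow> 'b" where
  "reflected \<nu> A = (if A \<in> sets circle then \<nu> (circle_reflect ` A) else 0)"

definition positive_matrix_measure :: "(real set \<Rightarrow> complex^'m^'m) \<Rightarrow> bool" where
  "positive_matrix_measure \<mu> \<longleftrightarrow> vector_measure circle \<mu> \<and>
     (\<forall>A\<in>sets circle. hermitian_psd cnj UNIV (\<lambda>p q. \<mu> A $ p $ q))"

definition associated_measure ::
  "(real set \<Rightarrow> quat^'s^'s) \<Rightarrow> real set \<Rightarrow> complex^('s + 's)^('s + 's)" where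
  "associated_measure \<nu> A =
     (let \<nu>1 = (\<lambda>A. mat_cpart1 (\<nu> A));
          \<nu>2 = (\<lambda>A. mat_cpart2 (\<nu> A));
          \<nu>3 = reflected (\<lambda>A. mat_cnj (\<nu>1 A))
      in block_matrix (\<nu>1 A) (\<nu>2 A) (mat_adj (\<nu>2 A)) (\<nu>3 A))"

definition q_positive :: "(real set \<Rightarrow> quat^'s^'s) \<Rightarrow> bool" where
  "q_positive \<nu> \<longleftrightarrow> vector_measure circle \<nu> \<and>
     positive_matrix_measure (associated_measure \<nu>) \<and>
     (\<forall>A\<in>sets circle.
        mat_cpart2 (\<nu> A) = - transpose (reflected (\<lambda>A. mat_cpart2 (\<nu> A)) A))"

definition quat_measure_integral ::
  "(real set \<Rightarrow> quat^'s^'s) \<Rightarrow> (real \<Rightarrow> complex) \<Rightarrow> quat^'s^'s" where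
  "quat_measure_integral \<nu> f = (\<chi> a b.
     quat_of_complex (complex_measure_integral circle (\<lambda>A. cpart1 (\<nu> A $ a $ b)) f) +
     quat_of_complex (complex_measure_integral circle (\<lambda>A. cpart2 (\<nu> A $ a $ b)) f) * quat_j)"

end

theory Submission
  imports Defs "HOL-Probability.Levy"
begin

text \<open>
  Writing a quaternionic \<open>s \<times> s\<close> matrix \<open>P = P\<^sub>1 + P\<^sub>2 j\<close> as the complex \<open>2s \<times> 2s\<close> matrix with rows
  \<open>(P\<^sub>1, P\<^sub>2)\<close> and \<open>(- cnj P\<^sub>2, cnj P\<^sub>1)\<close> turns a positive definite \<open>r\<close> into a positive definite
  sequence \<open>C\<close> of complex matrices, to which the matrix-valued Herglotz theorem applies: \<open>C\<close> consists
  of the Fourier coefficients of a unique positive matrix measure \<open>\<mu>\<close>. The symmetry of \<open>C\<close> and the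
  uniqueness of \<open>\<mu>\<close> force the symmetry of \<open>\<mu>\<close> under reflection of the circle, which says precisely
  that \<open>\<mu>\<close> is the measure associated with a q-positive \<open>\<nu>\<close>.

  The matrix-valued theorem follows from the scalar one by polarization. The scalar one holds because
  the Fejer means of the sequence are densities of measures on \<open>[0, 2\<pi>]\<close>, which have a weak limit point
  by Helly's theorem. Uniqueness is the density of trigonometric polynomials (Stone-Weierstrass).
\<close>

section \<open>Bounded functionals of measures\<close>

text \<open>Polarization removes this obstacle: every entry of a positive matrix measure is a
  combination of four finite measures \<open>v* \<mu> v\<close>, and the integral against a
  difference of finite measures does not depend on how the difference is written. From then on only
  linear functionals are compared.

  The symmetry arises as follows. Reflecting and conjugating a measure conjugates each of its
  Fourier coefficients. The lower blocks of \<open>C(n)\<close> are, up to sign, conjugates of the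
  upper ones. So block 22 of \<open>\<mu>\<close> is the reflected conjugate of block 11, which is
  \<open>\<nu>3\<close>, and block 21 is minus the reflected conjugate of block 12. As
  \<open>\<mu>\<close> is Hermitian, block 21 is also the adjoint of block 12, and the two
  descriptions together say that \<open>\<nu>2\<close> is minus its reflected transpose.\<close>

definition bounded_measurable :: "'x measure \<Rightarrow> ('x \<Rightarrow> complex) \<Rightarrow> bool" where
  "bounded_measurable M f \<longleftrightarrow> f \<in> borel_measurable M \<and> (\<exists>K. \<forall>x\<in>space M. norm (f x) \<le> K)"

text \<open>The functionals \<open>f \<mapsto> \<integral> f d\<kappa>\<close> for complex measures \<open>\<kappa>\<close>, axiomatized so that linear
  combinations need no Jordan decomposition. Only the values on bounded measurable \<open>f\<close> matter.\<close>

definition sigma_functional :: "'x measure \<Rightarrow> (('x \<Rightarrow> complex) \<Rightarrow> complex) \<Rightarrow> bool" where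
  "sigma_functional M I \<longleftrightarrow>
     (\<forall>f g. bounded_measurable M f \<longrightarrow> bounded_measurable M g \<longrightarrow> I (\<lambda>x. f x + g x) = I f + I g) \<and>
     (\<forall>c f. bounded_measurable M f \<longrightarrow> I (\<lambda>x. c * f x) = c * I f) \<and>
     (\<forall>F f K. (\<forall>k. F k \<in> borel_measurable M) \<longrightarrow> (\<forall>k. \<forall>x\<in>space M. norm (F k x) \<le> K) \<longrightarrow>
        f \<in> borel_measurable M \<longrightarrow> (\<forall>x\<in>space M. (\<lambda>k. F k x) \<longlonglongrightarrow> f x) \<longrightarrow> (\<lambda>k. I (F k)) \<longlonglongrightarrow> I f)"

lemma bounded_measurableI:
  assumes "f \<in> borel_measurable M" and "\<And>x. x \<in> space M \<Longrightarrow> norm (f x) \<le> K"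
  shows "bounded_measurable M f"
  using assms by (auto simp: bounded_measurable_def)

lemma bounded_measurable_add [intro]:
  assumes "bounded_measurable M f" "bounded_measurable M g"
  shows "bounded_measurable M (\<lambda>x. f x + g x)"
proof -
  obtain K L where "\<And>x. x \<in> space M \<Longrightarrow> norm (f x) \<le> K" "\<And>x. x \<in> space M \<Longrightarrow> norm (g x) \<le> L"
    using assms by (auto simp: bounded_measurable_def)
  then show ?thesis
    using assms by (intro bounded_measurableI[where K = "K + L"] norm_triangle_le add_mono)
      (auto simp: bounded_measurable_def)
qed

lemma bounded_measurable_cmult [intro]:
  assumes "bounded_measurable M f"
  shows "bounded_measurable M (\<lambda>x. c * f x)"
proof -
  obtain K where "\<And>x. x \<in> space M \<Longrightarrow> norm (f x) \<le> K"
    using assms by (auto simp: bounded_measurable_def)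
  then show ?thesis
    using assms by (intro bounded_measurableI[where K = "norm c * K"])
      (auto simp: bounded_measurable_def norm_mult intro!: mult_left_mono)
qed

lemma bounded_measurable_indicator [intro]:
  "A \<in> sets M \<Longrightarrow> bounded_measurable M (indicator A)"
  by (intro bounded_measurableI[where K = 1]) (auto simp: indicator_def)

lemma bounded_measurable_const [intro]: "bounded_measurable M (\<lambda>_. c)"
  by (intro bounded_measurableI[where K = "norm c"]) auto

lemma bounded_measurable_sum [intro]:
  "(\<And>j. j \<in> J \<Longrightarrow> bounded_measurable M (f j)) \<Longrightarrow> bounded_measurable M (\<lambda>x. \<Sum>j\<in>J. f j x)"
  by (induction J rule: infinite_finite_induct) auto

lemma borel_measurable_cnj [measurable (raw)]:
  "f \<in> borel_measurable M \<Longrightarrow> (\<lambda>x. cnj (f x)) \<in> borel_measurable M"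
  by (erule measurable_compose) (intro borel_measurable_continuous_onI continuous_intros)

lemma bounded_measurable_cnj_compose [intro]:
  assumes "bounded_measurable M f" "\<phi> \<in> measurable M M"
  shows "bounded_measurable M (\<lambda>x. cnj (f (\<phi> x)))"
proof -
  obtain K where "\<And>x. x \<in> space M \<Longrightarrow> norm (f x) \<le> K"
    using assms by (auto simp: bounded_measurable_def)
  moreover have "f \<in> borel_measurable M"
    using assms by (auto simp: bounded_measurable_def)
  ultimately show ?thesis
    using assms(2) by (intro bounded_measurableI[where K = K])
      (auto dest: measurable_space intro!: borel_measurable_cnj)
qed

context
  fixes M :: "'x measure" and I :: "('x \<Rightarrow> complex) \<Rightarrow> complex"
  assumes I: "sigma_functional M I"
begin

lemma sigma_functional_add:
  "bounded_measurable M f \<Longrightarrow> bounded_measurable M g \<Longrightarrow> I (\<lambda>x. f x + g x) = I f + I g"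
  using I by (auto simp: sigma_functional_def)

lemma sigma_functional_cmult:
  "bounded_measurable M f \<Longrightarrow> I (\<lambda>x. c * f x) = c * I f"
  using I by (auto simp: sigma_functional_def)

lemma sigma_functional_tendsto:
  assumes "\<And>k. F k \<in> borel_measurable M" "\<And>k x. x \<in> space M \<Longrightarrow> norm (F k x) \<le> K"
    and "\<And>x. x \<in> space M \<Longrightarrow> (\<lambda>k. F k x) \<longlonglongrightarrow> f x"
  shows "(\<lambda>k. I (F k)) \<longlonglongrightarrow> I f"
proof -
  have "f \<in> borel_measurable M"
    by (rule borel_measurable_LIMSEQ_metric[OF assms(1,3)])
  then show ?thesis
    using I[unfolded sigma_functional_def, THEN conjunct2, THEN conjunct2, rule_format, of F K f] assms
    by simp
qed

text \<open>The convergence axiom applied to the constant sequence \<open>f\<close>, which converges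
  to \<open>g\<close> on \<open>space M\<close>: values outside the space do not count.\<close>

lemma sigma_functional_cong:
  assumes "bounded_measurable M f" and "\<And>x. x \<in> space M \<Longrightarrow> f x = g x"
  shows "I f = I g"
proof -
  obtain K where "\<And>x. x \<in> space M \<Longrightarrow> norm (f x) \<le> K"
    using assms by (auto simp: bounded_measurable_def)
  then have "(\<lambda>k::nat. I f) \<longlonglongrightarrow> I g"
    using assms by (intro sigma_functional_tendsto[where K = K]) (auto simp: bounded_measurable_def)
  then show ?thesis
    by (simp add: LIMSEQ_const_iff)
qed

lemma sigma_functional_zero: "I (\<lambda>x. 0) = 0"
  using sigma_functional_cmult[of "\<lambda>x. 0" 0] by auto

lemma sigma_functional_sum:
  "(\<And>j. j \<in> J \<Longrightarrow> bounded_measurable M (f j)) \<Longrightarrow> I (\<lambda>x. \<Sum>j\<in>J. f j x) = (\<Sum>j\<in>J. I (f j))"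
  by (induction J rule: infinite_finite_induct)
    (auto simp: sigma_functional_zero sigma_functional_add bounded_measurable_sum)

text \<open>Partial sums of disjoint indicators are bounded by 1 and converge pointwise, so
  countable additivity is a case of bounded convergence.\<close>

lemma sigma_functional_sums_indicator:
  assumes "range A \<subseteq> sets M" "disjoint_family A"
  shows "(\<lambda>n. I (indicator (A n))) sums I (indicator (\<Union>n. A n))"
proof -
  have sets: "A n \<in> sets M" for n
    using assms by auto
  have *: "(\<Sum>i<k. I (indicator (A i))) = I (\<lambda>x. \<Sum>i<k. indicator (A i) x)" for k
    by (subst sigma_functional_sum) (use sets in auto)
  have "(\<lambda>k. I (\<lambda>x. \<Sum>i<k. indicator (A i) x)) \<longlonglongrightarrow> I (indicator (\<Union>n. A n))"
  proof (rule sigma_functional_tendsto[where K = 1])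
    fix k x
    show "(\<lambda>x. \<Sum>i<k. indicator (A i) x :: complex) \<in> borel_measurable M"
      using sets by measurable
    have "(\<Sum>i<k. indicator (A i) x :: complex) = indicator (\<Union>i<k. A i) x"
      using assms(2) by (subst indicator_UN_disjoint) (auto simp: disjoint_family_on_def)
    then show "norm (\<Sum>i<k. indicator (A i) x :: complex) \<le> 1"
      by (simp add: indicator_def)
  next
    fix x
    show "(\<lambda>k. \<Sum>i<k. indicator (A i) x :: complex) \<longlonglongrightarrow> indicator (\<Union>n. A n) x"
    proof -
      have "(\<lambda>i. indicator (A i) x :: complex) sums indicator (\<Union>n. A n) x"
      proof (cases "\<exists>i. x \<in> A i")
        case True
        then obtain i where i: "x \<in> A i" by auto
        have "indicator (A n) x = (if n = i then 1 else 0 :: complex)" for n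
          using assms(2) i by (auto simp: disjoint_family_on_def indicator_def)
        then show ?thesis
          using sums_single[of i "\<lambda>_. 1 :: complex"] i by (auto simp: indicator_def)
      qed (auto simp: indicator_def)
      then show ?thesis
        by (simp add: sums_def)
    qed
  qed
  then show ?thesis
    unfolding sums_def * .
qed

text \<open>\<open>f\<close> can be arbitrary because \<open>s\<close> has finitely many values.
  With \<open>f\<close> a mode this later turns integrals into finite sums over level sets.\<close>

lemma sigma_functional_simple:
  assumes s: "simple_function M s"
  shows "I (\<lambda>x. f (s x)) = (\<Sum>y\<in>s ` space M. f y * I (indicator (s -` {y} \<inter> space M)))"
proof -
  let ?g = "\<lambda>x. \<Sum>y\<in>s ` space M. f y * indicator (s -` {y} \<inter> space M) x"
  have sets: "s -` {y} \<inter> space M \<in> sets M" for y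
    using s by (rule simple_functionD(2))
  have "bounded_measurable M ?g"
    by (intro bounded_measurable_sum bounded_measurable_cmult bounded_measurable_indicator sets)
  moreover have "?g x = f (s x)" if "x \<in> space M" for x
  proof -
    have "?g x = (\<Sum>y\<in>s ` space M. if y = s x then f y else 0)"
      using that by (intro sum.cong) (auto simp: indicator_def)
    then show ?thesis
      using that simple_functionD(1)[OF s] by simp
  qed
  ultimately have "I (\<lambda>x. f (s x)) = I ?g"
    by (metis (no_types, lifting) sigma_functional_cong)
  also have "\<dots> = (\<Sum>y\<in>s ` space M. f y * I (indicator (s -` {y} \<inter> space M)))"
    by (subst sigma_functional_sum)
      (intro bounded_measurable_cmult bounded_measurable_indicator sets sum.cong sigma_functional_cmult refl)+
  finally show ?thesis .
qed

text \<open>Approximation by simple functions; the bound \<open>2 * K\<close> comes from the factor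
  2 in the standard approximating sequence.\<close>

lemma sigma_functional_eq_0I:
  assumes "\<And>A. A \<in> sets M \<Longrightarrow> I (indicator A) = 0" and f: "bounded_measurable M f"
  shows "I f = 0"
proof -
  obtain K where K: "\<And>x. x \<in> space M \<Longrightarrow> norm (f x) \<le> K" and "f \<in> borel_measurable M"
    using f by (auto simp: bounded_measurable_def)
  obtain F where "\<forall>i. simple_function M (F i)" "\<forall>x\<in>space M. (\<lambda>i. F i x) \<longlonglongrightarrow> f x"
      "\<forall>i. \<forall>x\<in>space M. dist (F i x) 0 \<le> 2 * dist (f x) 0"
    using borel_measurable_implies_sequence_metric[OF \<open>f \<in> borel_measurable M\<close>, of 0] by (elim exE conjE)
  then have F: "\<And>i. simple_function M (F i)" "\<And>x. x \<in> space M \<Longrightarrow> (\<lambda>i. F i x) \<longlonglongrightarrow> f x"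
      "\<And>i x. x \<in> space M \<Longrightarrow> dist (F i x) 0 \<le> 2 * dist (f x) 0"
    by simp_all
  have "I (F i) = 0" for i
    using sigma_functional_simple[OF F(1), of "\<lambda>z. z" i] simple_functionD(2)[OF F(1)] assms(1) by simp
  moreover have "(\<lambda>i. I (F i)) \<longlonglongrightarrow> I f"
  proof (rule sigma_functional_tendsto[where K = "2 * K"])
    show "F k \<in> borel_measurable M" for k
      using F(1) by (rule borel_measurable_simple_function)
    show "norm (F k x) \<le> 2 * K" if "x \<in> space M" for k x
      using F(3)[OF that, of k] K[OF that] by simp
  qed (use F in auto)
  ultimately show ?thesis
    by (simp add: LIMSEQ_const_iff)
qed

end

section \<open>Closure properties of sigma-functionals\<close>

lemma sigma_functional_plus:
  assumes "sigma_functional M I" "sigma_functional M J"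
  shows "sigma_functional M (\<lambda>f. I f + J f)"
  unfolding sigma_functional_def
proof (intro conjI allI impI)
  fix F :: "nat \<Rightarrow> 'a \<Rightarrow> complex" and f K
  assume "\<forall>k. F k \<in> borel_measurable M" "\<forall>k. \<forall>x\<in>space M. norm (F k x) \<le> (K::real)"
    "f \<in> borel_measurable M" "\<forall>x\<in>space M. (\<lambda>k. F k x) \<longlonglongrightarrow> f x"
  then show "(\<lambda>k. I (F k) + J (F k)) \<longlonglongrightarrow> I f + J f"
    by (intro tendsto_add sigma_functional_tendsto[OF assms(1), where K = K]
        sigma_functional_tendsto[OF assms(2), where K = K]) simp_all
qed (simp_all add: assms[THEN sigma_functional_add] assms[THEN sigma_functional_cmult] algebra_simps)

lemma sigma_functional_scale:
  assumes "sigma_functional M I"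
  shows "sigma_functional M (\<lambda>f. c * I f)"
  unfolding sigma_functional_def
proof (intro conjI allI impI)
  fix F :: "nat \<Rightarrow> 'a \<Rightarrow> complex" and f K
  assume "\<forall>k. F k \<in> borel_measurable M" "\<forall>k. \<forall>x\<in>space M. norm (F k x) \<le> (K::real)"
    "f \<in> borel_measurable M" "\<forall>x\<in>space M. (\<lambda>k. F k x) \<longlonglongrightarrow> f x"
  then show "(\<lambda>k. c * I (F k)) \<longlonglongrightarrow> c * I f"
    by (intro tendsto_mult tendsto_const sigma_functional_tendsto[OF assms, where K = K]) simp_all
qed (simp_all add: assms[THEN sigma_functional_add] assms[THEN sigma_functional_cmult] algebra_simps)

lemma sigma_functional_diff:
  assumes "sigma_functional M I" "sigma_functional M J"
  shows "sigma_functional M (\<lambda>f. I f - J f)"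
  using sigma_functional_plus[OF assms(1) sigma_functional_scale[OF assms(2), of "-1"]] by simp

lemma sigma_functional_0: "sigma_functional M (\<lambda>f. 0)"
  by (simp add: sigma_functional_def)

lemma sigma_functional_sum_fun:
  assumes "\<And>j. j \<in> J \<Longrightarrow> sigma_functional M (I j)"
  shows "sigma_functional M (\<lambda>f. \<Sum>j\<in>J. I j f)"
  using assms
proof (induction J rule: infinite_finite_induct)
  case (insert j J)
  then have "sigma_functional M (\<lambda>f. I j f + (\<Sum>j\<in>J. I j f))"
    by (intro sigma_functional_plus) simp_all
  with insert.hyps show ?case
    by simp
qed (simp_all add: sigma_functional_0)

text \<open>Conjugating both argument and value keeps the functional complex linear. With
  \<open>\<phi> = id\<close> it represents the conjugate measure, with \<open>circle_reflect\<close>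
  the conjugate of the reflected one.\<close>

lemma sigma_functional_cnj:
  assumes "sigma_functional M I" and \<phi>: "\<phi> \<in> measurable M M"
  shows "sigma_functional M (\<lambda>f. cnj (I (\<lambda>x. cnj (f (\<phi> x)))))"
  unfolding sigma_functional_def
proof (intro conjI allI impI)
  fix F :: "nat \<Rightarrow> 'a \<Rightarrow> complex" and f K
  assume F: "\<forall>k. F k \<in> borel_measurable M" "\<forall>k. \<forall>x\<in>space M. norm (F k x) \<le> (K::real)"
    "f \<in> borel_measurable M" "\<forall>x\<in>space M. (\<lambda>k. F k x) \<longlonglongrightarrow> f x"
  have "(\<lambda>k. I (\<lambda>x. cnj (F k (\<phi> x)))) \<longlonglongrightarrow> I (\<lambda>x. cnj (f (\<phi> x)))"
  proof (rule sigma_functional_tendsto[OF assms(1), where K = K])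
    show "(\<lambda>x. cnj (F k (\<phi> x))) \<in> borel_measurable M" for k
      by (intro borel_measurable_cnj measurable_compose[OF \<phi>] F(1)[rule_format])
    fix x assume "x \<in> space M"
    then have "\<phi> x \<in> space M"
      by (rule measurable_space[OF \<phi>])
    then show "norm (cnj (F k (\<phi> x))) \<le> K" "(\<lambda>k. cnj (F k (\<phi> x))) \<longlonglongrightarrow> cnj (f (\<phi> x))" for k
      using F by (auto intro: tendsto_cnj)
  qed
  then show "(\<lambda>k. cnj (I (\<lambda>x. cnj (F k (\<phi> x))))) \<longlonglongrightarrow> cnj (I (\<lambda>x. cnj (f (\<phi> x))))"
    by (rule tendsto_cnj)
next
  fix f g assume *: "bounded_measurable M f" "bounded_measurable M g"
  show "cnj (I (\<lambda>x. cnj (f (\<phi> x) + g (\<phi> x)))) =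
      cnj (I (\<lambda>x. cnj (f (\<phi> x)))) + cnj (I (\<lambda>x. cnj (g (\<phi> x))))"
    unfolding complex_cnj_add
    by (subst sigma_functional_add[OF assms(1)])
      (simp_all add: bounded_measurable_cnj_compose[OF _ \<phi>] *)
next
  fix f c assume *: "bounded_measurable M f"
  show "cnj (I (\<lambda>x. cnj (c * f (\<phi> x)))) = c * cnj (I (\<lambda>x. cnj (f (\<phi> x))))"
    unfolding complex_cnj_mult
    by (subst sigma_functional_cmult[OF assms(1)])
      (simp_all add: bounded_measurable_cnj_compose[OF _ \<phi>] *)
qed

lemma sigma_functional_eqI:
  assumes "sigma_functional M I" "sigma_functional M J"
    and "\<And>A. A \<in> sets M \<Longrightarrow> I (indicator A) = J (indicator A)" and "bounded_measurable M f"
  shows "I f = J f"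
  using sigma_functional_eq_0I[OF sigma_functional_diff[OF assms(1,2)] _ assms(4)] assms(3) by simp

lemma (in finite_measure) integrable_bounded_measurable:
  assumes "bounded_measurable N f" "sets M = sets N"
  shows "integrable M f"
proof -
  obtain K where "\<And>x. x \<in> space N \<Longrightarrow> norm (f x) \<le> K" and "f \<in> borel_measurable N"
    using assms by (auto simp: bounded_measurable_def)
  then show ?thesis
    using assms(2) sets_eq_imp_space_eq[OF assms(2)]
    by (intro integrable_const_bound[where B = K]) (auto simp: measurable_cong_sets[OF assms(2)])
qed

lemma sigma_functional_integral:
  assumes "finite_measure m" "sets m = sets M"
  shows "sigma_functional M (\<lambda>f. LINT x|m. f x)"
proof -
  interpret finite_measure m by fact
  note sp = sets_eq_imp_space_eq[OF assms(2)]
  show ?thesis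
    unfolding sigma_functional_def
  proof (intro conjI allI impI)
    fix F :: "nat \<Rightarrow> 'a \<Rightarrow> complex" and f K
    assume F: "\<forall>k. F k \<in> borel_measurable M" "\<forall>k. \<forall>x\<in>space M. norm (F k x) \<le> (K::real)"
      "f \<in> borel_measurable M" "\<forall>x\<in>space M. (\<lambda>k. F k x) \<longlonglongrightarrow> f x"
    then show "(\<lambda>k. LINT x|m. F k x) \<longlonglongrightarrow> (LINT x|m. f x)"
      by (intro integral_dominated_convergence[where w = "\<lambda>_. K"])
        (auto simp: measurable_cong_sets[OF assms(2)] sp)
  qed (simp_all add: integrable_bounded_measurable[OF _ assms(2)])
qed

lemma (in finite_measure) integral_complex_indicator:
  "A \<in> sets M \<Longrightarrow> (LINT x|M. (indicator A x :: complex)) = of_real (measure M A)"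
proof -
  have "(LINT x|M. (indicator A x :: complex)) = (LINT x|M. indicator A x *\<^sub>R 1)"
    by (intro Bochner_Integration.integral_cong) (auto simp: indicator_def)
  also assume "A \<in> sets M"
  then have "(LINT x|M. indicator A x *\<^sub>R (1::complex)) = measure M A *\<^sub>R 1"
    by (intro has_bochner_integral_integral_eq has_bochner_integral_indicator)
      (auto simp: emeasure_eq_measure)
  finally show ?thesis
    by (simp add: scaleR_conv_of_real)
qed

section \<open>Trigonometric polynomials on the circle\<close>

definition mode :: "int \<Rightarrow> real \<Rightarrow> complex" where
  "mode n t = exp (\<i> * of_int n * complex_of_real t)"

lemma mode_eq_cis: "mode n t = cis (of_int n * t)"
  by (simp add: mode_def cis_conv_exp mult.assoc)

lemma norm_mode [simp]: "norm (mode n t) = 1"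
  by (simp add: mode_eq_cis)

lemma mode_0 [simp]: "mode 0 t = 1"
  by (simp add: mode_def)

lemma mode_mult: "mode m t * mode n t = mode (m + n) t"
  by (simp add: mode_eq_cis cis_mult distrib_right)

lemma cnj_mode: "cnj (mode n t) = mode (- n) t"
  by (simp add: mode_eq_cis cis_cnj)

lemma continuous_on_mode [continuous_intros]: "continuous_on A (mode n)"
  unfolding mode_def by (intro continuous_intros)

lemma inj_on_cis: "inj_on cis {0..<2 * pi}"
proof (rule inj_onI)
  fix t u assume *: "t \<in> {0..<2 * pi}" "u \<in> {0..<2 * pi}" "cis t = cis u"
  then obtain n :: int where n: "t = u + 2 * pi * n"
    using sin_cos_eq_iff[of t u] by (auto simp: complex_eq_iff)
  have "\<bar>t - u\<bar> < 2 * pi"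
    using *(1,2) by auto
  moreover have "\<bar>t - u\<bar> = 2 * pi * \<bar>real_of_int n\<bar>"
    using n by (simp add: abs_mult)
  ultimately have "2 * pi * \<bar>real_of_int n\<bar> < 2 * pi * 1"
    by simp
  then have "n = 0"
    by simp
  with n show "t = u" by simp
qed

lemma space_circle: "space circle = {0..<2 * pi}"
  by (simp add: circle_def space_restrict_space)

lemma sets_circle_iff: "A \<in> sets circle \<longleftrightarrow> A \<in> sets borel \<and> A \<subseteq> {0..<2 * pi}"
  by (subst circle_def, subst sets_restrict_space_iff) auto

lemma measurable_circleI: "f \<in> borel_measurable borel \<Longrightarrow> f \<in> borel_measurable circle"
  unfolding circle_def by (rule measurable_restrict_space1)

lemma bounded_measurable_mode [simp]: "bounded_measurable circle (mode n)"
  by (intro bounded_measurableI[where K = 1] measurable_circleI borel_measurable_continuous_onI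
      continuous_intros) simp

inductive trig_poly :: "(real \<Rightarrow> complex) \<Rightarrow> bool" where
  trig_poly_mode: "trig_poly (\<lambda>t. c * mode n t)"
| trig_poly_add: "trig_poly f \<Longrightarrow> trig_poly g \<Longrightarrow> trig_poly (\<lambda>t. f t + g t)"

lemma trig_poly_mult_mode:
  assumes "trig_poly g"
  shows "trig_poly (\<lambda>t. c * mode n t * g t)"
  using assms
proof induction
  case (trig_poly_mode d m)
  have "(\<lambda>t. c * mode n t * (d * mode m t)) = (\<lambda>t. (c * d) * mode (n + m) t)"
    by (simp add: mode_mult[symmetric] fun_eq_iff)
  then show ?case
    by (metis trig_poly.trig_poly_mode)
next
  case (trig_poly_add f g)
  then show ?case
    unfolding distrib_left by (intro trig_poly.trig_poly_add)
qed

lemma trig_poly_mult: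
  assumes "trig_poly f" "trig_poly g"
  shows "trig_poly (\<lambda>t. f t * g t)"
  using assms
proof induction
  case (trig_poly_add f g)
  then show ?case
    unfolding distrib_right by (intro trig_poly.trig_poly_add)
qed (rule trig_poly_mult_mode)

text \<open>Real polynomials on the plane are generated by real-linear functionals and constants. On
  the circle such a functional is \<open>f 1 * cos t + f \<i> * sin t\<close>, a combination of
  \<open>mode 1\<close> and \<open>mode (-1)\<close> by Euler's formula.\<close>

lemma trig_poly_polynomial_cis:
  assumes "real_polynomial_function p"
  shows "trig_poly (\<lambda>t. complex_of_real (p (cis t)))"
  using assms
proof induction
  case (linear f)
  interpret bounded_linear f by fact
  let ?a = "complex_of_real (f 1) / 2" and ?b = "complex_of_real (f \<i>) / 2"
  have "complex_of_real (f (cis t)) = (?a - \<i> * ?b) * mode 1 t + (?a + \<i> * ?b) * mode (-1) t" for t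
  proof -
    have "cis t = cos t *\<^sub>R 1 + sin t *\<^sub>R \<i>"
      by (simp add: complex_eq_iff)
    then have "f (cis t) = cos t * f 1 + sin t * f \<i>"
      by (simp only: add scaleR real_scaleR_def)
    then show ?thesis
      by (simp add: mode_eq_cis complex_eq_iff)
  qed
  then show ?case
    by (simp only:) (intro trig_poly.intros)
next
  case (const c)
  then show ?case
    using trig_poly_mode[of "of_real c" 0] by simp
qed (simp_all add: trig_poly_add trig_poly_mult)

section \<open>Uniqueness: functionals that vanish on all modes\<close>

context
  fixes I :: "(real \<Rightarrow> complex) \<Rightarrow> complex"
  assumes I: "sigma_functional circle I" and I_mode: "\<And>n. I (mode n) = 0"
begin

lemma sigma_functional_trig_poly:
  assumes "trig_poly f"
  shows "bounded_measurable circle f \<and> I f = 0"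
  using assms
  by induction (auto simp: sigma_functional_add[OF I] sigma_functional_cmult[OF I] I_mode)

text \<open>Writing functions as \<open>f (cis t)\<close> builds in the identification of 0 with 2
  pi and makes the domain a compact circle, where Stone-Weierstrass applies.\<close>

lemma sigma_functional_continuous_cis:
  assumes f: "continuous_on UNIV (f :: complex \<Rightarrow> real)"
  shows "I (\<lambda>t. of_real (f (cis t))) = 0"
proof -
  have cont: "continuous_on (sphere 0 1) f"
    using f by (rule continuous_on_subset) simp
  have "\<exists>g. real_polynomial_function g \<and> (\<forall>z\<in>sphere 0 1. \<bar>f z - g z\<bar> < 1 / Suc k)" for k
    by (rule Stone_Weierstrass_real_polynomial_function[OF compact_sphere cont, of "1 / Suc k"]) auto
  then obtain g where g: "\<And>k. real_polynomial_function (g k)"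
      "\<And>k z. z \<in> sphere 0 1 \<Longrightarrow> \<bar>f z - g k z\<bar> < 1 / Suc k"
    by metis
  have "bounded (f ` sphere 0 1)"
    by (intro compact_imp_bounded compact_continuous_image[OF cont]) auto
  then obtain B where B: "\<And>z. z \<in> sphere 0 1 \<Longrightarrow> \<bar>f z\<bar> \<le> B"
    unfolding bounded_iff by (metis imageI real_norm_def)
  have "(\<lambda>k. I (\<lambda>t. of_real (g k (cis t)))) \<longlonglongrightarrow> I (\<lambda>t. of_real (f (cis t)))"
  proof (rule sigma_functional_tendsto[OF I, where K = "B + 1"])
    show "(\<lambda>t. complex_of_real (g k (cis t))) \<in> borel_measurable circle" for k
      using sigma_functional_trig_poly[OF trig_poly_polynomial_cis[OF g(1)], of k]
      by (simp add: bounded_measurable_def)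
    fix t
    have cis: "cis t \<in> sphere 0 1" by simp
    show "norm (complex_of_real (g k (cis t))) \<le> B + 1" for k
    proof -
      have "1 / real (Suc k) \<le> 1" by simp
      then show ?thesis
        using g(2)[OF cis, of k] B[OF cis] unfolding norm_of_real by linarith
    qed
    have "(\<lambda>k. f (cis t) - g k (cis t)) \<longlonglongrightarrow> 0"
    proof (rule Lim_null_comparison)
      show "\<forall>\<^sub>F k in sequentially. norm (f (cis t) - g k (cis t)) \<le> 1 / Suc k"
        using g(2)[OF cis] by (intro always_eventually) (auto intro: less_imp_le)
      show "(\<lambda>k. 1 / real (Suc k)) \<longlonglongrightarrow> 0"
        using LIMSEQ_inverse_real_of_nat by (simp add: inverse_eq_divide)
    qed
    from tendsto_diff[OF tendsto_const[of "f (cis t)"] this]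
    show "(\<lambda>k. complex_of_real (g k (cis t))) \<longlonglongrightarrow> of_real (f (cis t))"
      by (intro tendsto_of_real) simp
  qed
  then show ?thesis
    by (simp add: sigma_functional_trig_poly[OF trig_poly_polynomial_cis[OF g(1)]] LIMSEQ_const_iff)
qed

text \<open>\<open>C = {}\<close> is excluded because \<^term>\<open>infdist z {} = 0\<close>.\<close>

lemma sigma_functional_closed_cis:
  assumes C: "closed C" "C \<noteq> {}"
  shows "I (\<lambda>t. indicator C (cis t)) = 0"
proof -
  \<comment> \<open>Continuous tents that decrease to the indicator of the closed set: off
    \<open>C\<close> they vanish as soon as \<open>k * infdist z C \<ge> 1\<close>.\<close>
  let ?g = "\<lambda>k z. max 0 (1 - real k * infdist z C)"
  have cont: "continuous_on UNIV (?g k)" for k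
    by (intro continuous_intros)
  have "(\<lambda>k. I (\<lambda>t. of_real (?g k (cis t)))) \<longlonglongrightarrow> I (\<lambda>t. indicator C (cis t))"
  proof (rule sigma_functional_tendsto[OF I, where K = 1])
    show "(\<lambda>t. complex_of_real (?g k (cis t))) \<in> borel_measurable circle" for k
      by (intro measurable_circleI borel_measurable_continuous_onI continuous_intros)
    show "norm (complex_of_real (?g k (cis t))) \<le> 1" for k t
      using infdist_nonneg[of "cis t" C] by (simp only: norm_of_real) auto
    fix t
    show "(\<lambda>k. complex_of_real (?g k (cis t))) \<longlonglongrightarrow> indicator C (cis t)"
    proof (cases "cis t \<in> C")
      case False
      then have d: "infdist (cis t) C > 0"
        using C infdist_pos_not_in_closed by blast
      obtain N where "1 / infdist (cis t) C < real N"
        using reals_Archimedean2 by blast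
      then have "?g k (cis t) = 0" if "k \<ge> N" for k
        using that d by (simp add: field_simps)
          (smt (verit, best) mult_right_mono of_nat_le_iff mult.commute)
      then have "\<forall>\<^sub>F k in sequentially. complex_of_real (?g k (cis t)) = 0"
        by (auto simp: eventually_sequentially)
      then show ?thesis
        using False by (simp add: tendsto_eventually)
    qed simp
  qed
  then show ?thesis
    by (simp add: sigma_functional_continuous_cis[OF cont] LIMSEQ_const_iff)
qed

text \<open>Dynkin's argument with the half-lines \<open>{..a}\<close> as intersection-stable
  generator of the Borel sets of the line, evaluated throughout on the trace in
  \<open>[0, 2 pi)\<close>.\<close>

lemma sigma_functional_mode_indicator:
  assumes "A \<in> sets circle"
  shows "I (indicator A) = 0"
proof -
  have one: "I (\<lambda>_. 1) = 0"
    using I_mode[of 0] unfolding mode_def[abs_def] by simp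
  let ?C = "\<lambda>B. B \<inter> {0..<2 * pi}"
  have sets: "?C B \<in> sets circle" if "B \<in> sets borel" for B
    using that by (auto simp: sets_circle_iff)
  have borel: "B \<in> sigma_sets UNIV (range (\<lambda>a::real. {..a})) \<Longrightarrow> B \<in> sets borel" for B
    by (subst borel_eq_atMost) simp
  have "A \<in> sigma_sets UNIV (range (\<lambda>a::real. {..a}))"
    using assms by (subst (asm) sets_circle_iff, subst (asm) borel_eq_atMost) simp
  then have "I (indicator (?C A)) = 0"
  proof (induction rule: sigma_sets_induct_disjoint[rotated 2, consumes 1, case_names basic empty compl union])
    case (basic B)
    then obtain a where B: "B = {..a}" by auto
    consider "a < 0" | "0 \<le> a" "a < 2 * pi" | "2 * pi \<le> a" by linarith
    then show ?case
    proof cases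
      case 1
      then have "?C B = {}" using B by auto
      then show ?thesis
        using sigma_functional_zero[OF I] by (simp add: indicator_def[abs_def])
    next
      \<comment> \<open>The trace is \<open>[0, a]\<close>, the preimage under \<open>cis\<close> of
        a closed arc; injectivity of \<open>cis\<close> requires \<open>a < 2 * pi\<close>.\<close>
      case 2
      have "compact (cis ` {0..a})"
        by (intro compact_continuous_image continuous_intros) auto
      then have "I (\<lambda>t. indicator (cis ` {0..a}) (cis t)) = 0"
        using 2 by (intro sigma_functional_closed_cis compact_imp_closed) auto
      moreover have "I (indicator (?C B)) = I (\<lambda>t. indicator (cis ` {0..a}) (cis t))"
      proof (rule sigma_functional_cong[OF I])
        fix t assume t: "t \<in> space circle"
        have "cis t \<in> cis ` {0..a} \<longleftrightarrow> t \<in> {0..a}"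
        proof
          assume "cis t \<in> cis ` {0..a}"
          then obtain u where u: "u \<in> {0..a}" "cis t = cis u" by auto
          then have "t = u"
            using t 2 by (intro inj_onD[OF inj_on_cis, of t u]) (auto simp: space_circle)
          then show "t \<in> {0..a}" using u by simp
        qed auto
        then show "indicator (?C B) t = (indicator (cis ` {0..a}) (cis t) :: complex)"
          using t 2 B by (auto simp: indicator_def space_circle)
      qed (use B sets in auto)
      ultimately show ?thesis by simp
    next
      case 3
      have "I (indicator (?C B)) = I (\<lambda>_. 1)"
        using 3 B sets[of B] by (intro sigma_functional_cong[OF I]) (auto simp: space_circle)
      then show ?thesis using one by simp
    qed
  next
    case empty
    show ?case
      using sigma_functional_zero[OF I] by (simp add: indicator_def[abs_def])
  next
    case (compl B)
    have "I (\<lambda>t. indicator (?C (UNIV - B)) t + indicator (?C B) t) = I (\<lambda>_. 1)"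
      using borel[OF compl(1)] by (intro sigma_functional_cong[OF I] bounded_measurable_add
          bounded_measurable_indicator sets) (auto simp: space_circle indicator_def)
    moreover have "I (\<lambda>t. indicator (?C (UNIV - B)) t + indicator (?C B) t) =
        I (indicator (?C (UNIV - B))) + I (indicator (?C B))"
      using borel[OF compl(1)] by (intro sigma_functional_add[OF I] bounded_measurable_indicator sets) auto
    ultimately show ?case
      using one compl by simp
  next
    case (union B)
    have "(\<lambda>n. I (indicator (?C (B n)))) sums I (indicator (\<Union>n. ?C (B n)))"
      using union(1,2) borel by (intro sigma_functional_sums_indicator[OF I])
        (auto simp: disjoint_family_on_def intro!: sets)
    then have "(\<lambda>n. 0) sums I (indicator (\<Union>n. ?C (B n)))"
      by (simp only: union(3))
    then show ?case
      by (simp add: sums_unique2[OF _ sums_zero])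
  qed (auto simp: Int_stable_def)
  moreover have "?C A = A"
    using assms by (auto simp: sets_circle_iff)
  ultimately show ?thesis
    by simp
qed

end

text \<open>In this form, later identities between measures are read off from Fourier
  coefficients.\<close>

lemma sigma_functional_mode_eqI:
  assumes "sigma_functional circle I" "sigma_functional circle J"
    and "\<And>n. I (mode n) = J (mode n)" and "bounded_measurable circle f"
  shows "I f = J f"
proof -
  note diff = sigma_functional_diff[OF assms(1,2)]
  have "I (indicator A) - J (indicator A) = 0" if "A \<in> sets circle" for A
    by (rule sigma_functional_mode_indicator[OF diff _ that]) (simp add: assms(3))
  then show ?thesis
    by (intro sigma_functional_eqI[OF assms(1,2) _ assms(4)]) simp
qed

section \<open>Jordan decomposition of differences of finite measures\<close>

lemma vector_measure_empty:
  assumes "vector_measure M \<nu>"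
  shows "\<nu> {} = 0"
proof -
  have "(\<lambda>n::nat. \<nu> {}) sums \<nu> (\<Union>n::nat. {})"
    using assms unfolding vector_measure_def by (auto simp: disjoint_family_on_def)
  then show ?thesis
    by (auto dest: sums_summable simp: summable_const_iff)
qed

lemma vector_measure_sums:
  "vector_measure M \<nu> \<Longrightarrow> range F \<subseteq> sets M \<Longrightarrow> disjoint_family F \<Longrightarrow>
    (\<lambda>n. \<nu> (F n)) sums \<nu> (\<Union>n::nat. F n)"
  by (simp add: vector_measure_def)

lemma vector_measure_notin: "vector_measure M \<nu> \<Longrightarrow> A \<notin> sets M \<Longrightarrow> \<nu> A = 0"
  by (simp add: vector_measure_def)

text \<open>The explicit form of \<open>N\<close> is passed on because \<open>positive_part\<close>
  is itself a \<open>measure_of\<close>, so that the two can be matched by comparing set functions.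
  The last equation covers all \<open>A\<close>, both sides being 0 off the sigma-algebra.\<close>

lemma nonneg_vector_measure:
  assumes \<phi>: "vector_measure M \<phi>" and nn: "\<And>A. A \<in> sets M \<Longrightarrow> 0 \<le> (\<phi> A :: real)"
  obtains N where "N = measure_of (space M) (sets M) (\<lambda>A. ennreal (\<phi> A))"
    "finite_measure N" "sets N = sets M" "\<And>A. measure N A = \<phi> A"
proof
  let ?N = "measure_of (space M) (sets M) (\<lambda>A. ennreal (\<phi> A))"
  show sets: "sets ?N = sets M"
    by simp
  have em: "emeasure ?N A = ennreal (\<phi> A)" if "A \<in> sets M" for A
  proof (rule emeasure_measure_of_sigma[OF sets.sigma_algebra_axioms _ _ that])
    show "positive (sets M) (\<lambda>A. ennreal (\<phi> A))"
      by (simp add: positive_def vector_measure_empty[OF \<phi>])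
    show "countably_additive (sets M) (\<lambda>A. ennreal (\<phi> A))"
    proof (rule countably_additiveI)
      fix F :: "nat \<Rightarrow> _" assume F: "range F \<subseteq> sets M" "disjoint_family F"
      then have "(\<lambda>n. \<phi> (F n)) sums \<phi> (\<Union>n. F n)"
        by (rule vector_measure_sums[OF \<phi>])
      then show "(\<Sum>n. ennreal (\<phi> (F n))) = ennreal (\<phi> (\<Union>n. F n))"
        using F nn by (subst suminf_ennreal2) (auto simp: sums_iff)
    qed
  qed
  show "finite_measure ?N"
    by (intro finite_measureI) (simp add: em space_measure_of_conv)
  show "measure ?N A = \<phi> A" for A
  proof (cases "A \<in> sets M")
    case True
    then show ?thesis by (simp add: measure_def em nn)
  next
    case False
    then show ?thesis using sets by (simp add: measure_notin_sets vector_measure_notin[OF \<phi>])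
  qed
qed simp

text \<open>On a Hahn set \<open>Y\<close> of \<open>\<alpha> - \<beta>\<close> the supremum defining \<^const>\<open>positive_part\<close> is attained at \<open>A \<inter> Y\<close>.\<close>

lemma positive_part_hahn:
  assumes "finite_measure \<alpha>" "finite_measure \<beta>" "sets \<alpha> = sets M" "sets \<beta> = sets M"
    and Y: "Y \<in> sets M"
    and le: "\<And>X. X \<in> sets M \<Longrightarrow> X \<subseteq> Y \<Longrightarrow> measure \<beta> X \<le> measure \<alpha> X"
    and ge: "\<And>X. X \<in> sets M \<Longrightarrow> X \<inter> Y = {} \<Longrightarrow> measure \<alpha> X \<le> measure \<beta> X"
  obtains N where "positive_part M (\<lambda>A. measure \<alpha> A - measure \<beta> A) = N"
    "finite_measure N" "sets N = sets M"
    "\<And>A. A \<in> sets M \<Longrightarrow> measure N A = measure \<alpha> (A \<inter> Y) - measure \<beta> (A \<inter> Y)"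
proof -
  interpret \<alpha>: finite_measure \<alpha> by fact
  interpret \<beta>: finite_measure \<beta> by fact
  define \<phi> where "\<phi> A = (if A \<in> sets M then measure \<alpha> (A \<inter> Y) - measure \<beta> (A \<inter> Y) else 0)" for A
  have \<phi>: "vector_measure M \<phi>"
    unfolding vector_measure_def
  proof (intro conjI allI impI)
    fix F :: "nat \<Rightarrow> _" assume F: "range F \<subseteq> sets M" "disjoint_family F"
    have FY: "range (\<lambda>n. F n \<inter> Y) \<subseteq> sets M" "disjoint_family (\<lambda>n. F n \<inter> Y)"
      using F Y by (auto simp: disjoint_family_on_def)
    have eq: "(\<Union>n. F n) \<inter> Y = (\<Union>n. F n \<inter> Y)" by auto
    have "(\<lambda>n. measure \<alpha> (F n \<inter> Y) - measure \<beta> (F n \<inter> Y)) sums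
        (measure \<alpha> (\<Union>n. F n \<inter> Y) - measure \<beta> (\<Union>n. F n \<inter> Y))"
      using FY assms(3,4) by (intro sums_diff \<alpha>.finite_measure_UNION \<beta>.finite_measure_UNION) auto
    moreover have "F n \<in> sets M" "(\<Union>n. F n) \<in> sets M" for n
      using F by auto
    ultimately show "(\<lambda>n. \<phi> (F n)) sums \<phi> (\<Union>n. F n)"
      unfolding \<phi>_def by (simp only: eq if_True)
  qed (simp add: \<phi>_def)
  have nn: "0 \<le> \<phi> A" if "A \<in> sets M" for A
    using that Y by (simp add: \<phi>_def le sets.Int)
  obtain N where N: "N = measure_of (space M) (sets M) (\<lambda>A. ennreal (\<phi> A))"
      "finite_measure N" "sets N = sets M" "\<And>A. measure N A = \<phi> A"
    using nonneg_vector_measure[OF \<phi> nn] by blast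
  have "(SUP B\<in>{B \<in> sets M. B \<subseteq> A}. ennreal (measure \<alpha> B - measure \<beta> B)) = ennreal (\<phi> A)"
    if A: "A \<in> sets M" for A
  proof (intro antisym SUP_least)
    fix B assume "B \<in> {B \<in> sets M. B \<subseteq> A}"
    then have B: "B \<in> sets M" "B \<subseteq> A" by auto
    have sets: "B \<inter> Y \<in> sets M" "B - Y \<in> sets M" "A \<inter> Y - B \<in> sets M" "A \<inter> Y \<in> sets M"
      using A B Y by auto
    have split: "measure m B = measure m (B \<inter> Y) + measure m (B - Y)"
        "measure m (A \<inter> Y) = measure m (B \<inter> Y) + measure m (A \<inter> Y - B)"
      if "finite_measure m" "sets m = sets M" for m
    proof -
      interpret finite_measure m by fact
      have "measure m ((B \<inter> Y) \<union> (B - Y)) = measure m (B \<inter> Y) + measure m (B - Y)"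
        using sets that(2) by (intro finite_measure_Union) auto
      moreover have "measure m ((B \<inter> Y) \<union> (A \<inter> Y - B)) = measure m (B \<inter> Y) + measure m (A \<inter> Y - B)"
        using sets that(2) by (intro finite_measure_Union) auto
      moreover have "(B \<inter> Y) \<union> (B - Y) = B" "(B \<inter> Y) \<union> (A \<inter> Y - B) = A \<inter> Y"
        using B by auto
      ultimately show "measure m B = measure m (B \<inter> Y) + measure m (B - Y)"
        "measure m (A \<inter> Y) = measure m (B \<inter> Y) + measure m (A \<inter> Y - B)"
        by simp_all
    qed
    \<comment> \<open>Discarding \<open>B - Y\<close>, where \<open>\<alpha> - \<beta>\<close> is at
      most 0, and adding \<open>A \<inter> Y - B\<close>, where it is at least 0, can only increase
      the difference.\<close>
    have "measure \<alpha> (B - Y) \<le> measure \<beta> (B - Y)"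
      using sets by (intro ge) auto
    moreover have "measure \<beta> (A \<inter> Y - B) \<le> measure \<alpha> (A \<inter> Y - B)"
      using sets by (intro le) auto
    ultimately show "ennreal (measure \<alpha> B - measure \<beta> B) \<le> ennreal (\<phi> A)"
      using split[OF assms(1,3)] split[OF assms(2,4)] A by (intro ennreal_leI) (simp add: \<phi>_def)
  next
    show "ennreal (\<phi> A) \<le> (SUP B\<in>{B \<in> sets M. B \<subseteq> A}. ennreal (measure \<alpha> B - measure \<beta> B))"
      using A Y by (intro SUP_upper2[of "A \<inter> Y"]) (auto simp: \<phi>_def)
  qed
  then have "positive_part M (\<lambda>A. measure \<alpha> A - measure \<beta> A) = N"
    unfolding positive_part_def N(1)
    by (intro measure_of_eq) (auto simp: sets.space_closed sets.sigma_sets_eq)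
  then show ?thesis
    using N by (intro that[of N]) (simp_all add: \<phi>_def)
qed

text \<open>The two parts \<open>P\<close> and \<open>Q\<close> live on complementary Hahn sets and
  satisfy \<open>P - Q = \<alpha> - \<beta>\<close> on every measurable set, hence as functionals.
  So any representation as a difference of finite measures computes the Jordan integral.\<close>

lemma signed_integral_diff:
  assumes \<alpha>: "finite_measure \<alpha>" "sets \<alpha> = sets M" and \<beta>: "finite_measure \<beta>" "sets \<beta> = sets M"
    and f: "bounded_measurable M f"
  shows "signed_integral M (\<lambda>A. measure \<alpha> A - measure \<beta> A) f = (LINT x|\<alpha>. f x) - (LINT x|\<beta>. f x)"
proof -
  interpret \<alpha>: finite_measure \<alpha> by fact
  interpret \<beta>: finite_measure \<beta> by fact
  obtain Y where Y: "Y \<in> sets M"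
      "\<And>X. X \<in> sets M \<Longrightarrow> X \<subseteq> Y \<Longrightarrow> measure \<beta> X \<le> measure \<alpha> X"
      "\<And>X. X \<in> sets M \<Longrightarrow> X \<inter> Y = {} \<Longrightarrow> measure \<alpha> X \<le> measure \<beta> X"
    using finite_unsigned_Hahn_decomposition[OF \<alpha>(1) \<beta>(1)] \<alpha>(2) \<beta>(2)
    by (auto simp: \<alpha>.emeasure_eq_measure \<beta>.emeasure_eq_measure)
  let ?Z = "space M - Y"
  obtain P where P: "positive_part M (\<lambda>A. measure \<alpha> A - measure \<beta> A) = P" "finite_measure P"
      "sets P = sets M" "\<And>A. A \<in> sets M \<Longrightarrow> measure P A = measure \<alpha> (A \<inter> Y) - measure \<beta> (A \<inter> Y)"
    using positive_part_hahn[OF \<alpha>(1) \<beta>(1) \<alpha>(2) \<beta>(2) Y] by blast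
  \<comment> \<open>The complement of \<open>Y\<close> is a Hahn set for
    \<open>\<beta> - \<alpha>\<close>.\<close>
  have Z: "?Z \<in> sets M"
    using Y(1) by (rule sets.compl_sets)
  have Z': "measure \<alpha> X \<le> measure \<beta> X" if "X \<in> sets M" "X \<subseteq> ?Z" for X
    using that by (intro Y(3)) auto
  have Z'': "measure \<beta> X \<le> measure \<alpha> X" if "X \<in> sets M" "X \<inter> ?Z = {}" for X
    using that sets.sets_into_space[of X M] by (intro Y(2)) auto
  obtain Q where Q: "positive_part M (\<lambda>A. measure \<beta> A - measure \<alpha> A) = Q" "finite_measure Q"
      "sets Q = sets M" "\<And>A. A \<in> sets M \<Longrightarrow> measure Q A = measure \<beta> (A \<inter> ?Z) - measure \<alpha> (A \<inter> ?Z)"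
    using positive_part_hahn[OF \<beta>(1) \<alpha>(1) \<beta>(2) \<alpha>(2) Z Z' Z''] by blast
  note fin = finite_measure.integral_complex_indicator
  have "(LINT x|P. f x) - (LINT x|Q. f x) = (LINT x|\<alpha>. f x) - (LINT x|\<beta>. f x)"
  proof (rule sigma_functional_eqI[OF _ _ _ f])
    fix A assume A: "A \<in> sets M"
    have split: "measure m A = measure m (A \<inter> Y) + measure m (A \<inter> ?Z)"
      if "finite_measure m" "sets m = sets M" for m
    proof -
      interpret finite_measure m by fact
      have "measure m ((A \<inter> Y) \<union> (A \<inter> ?Z)) = measure m (A \<inter> Y) + measure m (A \<inter> ?Z)"
        using A Y(1) that(2) by (intro finite_measure_Union) auto
      moreover have "(A \<inter> Y) \<union> (A \<inter> ?Z) = A"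
        using sets.sets_into_space[OF A] by auto
      ultimately show ?thesis by simp
    qed
    have "measure P A - measure Q A = measure \<alpha> A - measure \<beta> A"
      using A P(4) Q(4) split[OF \<alpha>] split[OF \<beta>] by simp
    then show "(LINT x|P. indicator A x) - (LINT x|Q. indicator A x :: complex) =
        (LINT x|\<alpha>. indicator A x) - (LINT x|\<beta>. indicator A x)"
      using A P(2,3) Q(2,3) \<alpha> \<beta> by (simp add: fin flip: of_real_diff)
  qed (intro sigma_functional_diff sigma_functional_integral P Q \<alpha> \<beta>)+
  then show ?thesis
    unfolding signed_integral_def minus_diff_eq P(1) Q(1) .
qed

text \<open>The shape matches \<open>polarization\<close>: index \<open>k\<close> belongs to the
  factor \<open>\<i> ^ k\<close>, and the imaginary part is 3 minus 1 because the quadratic form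
  conjugates its left vector.\<close>

lemma complex_measure_integral_combination:
  assumes m: "\<And>i. finite_measure (m i)" "\<And>i. sets (m i) = sets M"
    and \<kappa>: "\<And>A. \<kappa> A = complex_of_real (measure (m 0) A - measure (m 2) A) +
                     \<i> * complex_of_real (measure (m 3) A - measure (m (1::nat)) A)"
    and f: "bounded_measurable M f"
  shows "complex_measure_integral M \<kappa> f =
    ((LINT x|m 0. f x) - (LINT x|m 2. f x)) + \<i> * ((LINT x|m 3. f x) - (LINT x|m 1. f x))"
proof -
  have "Re (\<kappa> A) = measure (m 0) A - measure (m 2) A" "Im (\<kappa> A) = measure (m 3) A - measure (m 1) A" for A
    by (simp_all add: \<kappa>)
  then show ?thesis
    unfolding complex_measure_integral_def by (simp add: signed_integral_diff m f)
qed

section \<open>Positive matrix-valued measures and polarization\<close>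

definition quad_form :: "('i::finite \<Rightarrow> 'i \<Rightarrow> complex) \<Rightarrow> ('i \<Rightarrow> complex) \<Rightarrow> complex" where
  "quad_form A v = (\<Sum>p\<in>UNIV. \<Sum>q\<in>UNIV. cnj (v p) * A p q * v q)"

text \<open>The vector \<open>(e_p + \<i> ^ k e_q) / 2\<close>; halving absorbs the usual
  denominator 4 of polarization.\<close>

definition polar_vec :: "nat \<Rightarrow> 'i \<Rightarrow> 'i \<Rightarrow> 'i \<Rightarrow> complex" where
  "polar_vec k p q x = (of_bool (x = p) + \<i> ^ k * of_bool (x = q)) / 2"

lemma hermitian_psd_UNIV:
  "hermitian_psd cnj UNIV A \<longleftrightarrow> (\<forall>p q. A q p = cnj (A p q)) \<and> (\<forall>v. quad_form A v \<in> \<real>\<^sub>\<ge>\<^sub>0)"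
  by (simp add: hermitian_psd_def quad_form_def)

lemma quad_form_polar_vec:
  "4 * quad_form A (polar_vec k p q) =
    A p p + \<i> ^ k * A p q + cnj (\<i> ^ k) * A q p + cnj (\<i> ^ k) * \<i> ^ k * A q q"
proof -
  have *: "cnj (polar_vec k p q x) * A x y * polar_vec k p q y =
      (of_bool (x = p) * (of_bool (y = p) * A x y) + of_bool (x = p) * (of_bool (y = q) * (\<i> ^ k * A x y))
       + of_bool (x = q) * (of_bool (y = p) * (cnj (\<i> ^ k) * A x y))
       + of_bool (x = q) * (of_bool (y = q) * (cnj (\<i> ^ k) * \<i> ^ k * A x y))) / 4" for x y
    by (simp add: polar_vec_def field_simps)
  have of_bool_sum: "(\<Sum>x\<in>UNIV. of_bool (x = r) * f x) = f r" for r and f :: "'a \<Rightarrow> complex"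
    by (simp add: of_bool_def if_distrib[where f = "\<lambda>z. z * _"] cong: if_cong)
  show ?thesis
    unfolding quad_form_def *
    by (simp add: sum_divide_distrib[symmetric] sum.distrib sum_distrib_left[symmetric] of_bool_sum)
qed

lemma polarization:
  "A p q = (quad_form A (polar_vec 0 p q) - quad_form A (polar_vec 2 p q)) +
    \<i> * (quad_form A (polar_vec 3 p q) - quad_form A (polar_vec 1 p q))"
proof -
  have "4 * A p q = (4 * quad_form A (polar_vec 0 p q) - 4 * quad_form A (polar_vec 2 p q)) +
    \<i> * (4 * quad_form A (polar_vec 3 p q) - 4 * quad_form A (polar_vec 1 p q))"
    unfolding quad_form_polar_vec by (simp add: power3_eq_cube power2_eq_square algebra_simps)
  also have "\<dots> = 4 * ((quad_form A (polar_vec 0 p q) - quad_form A (polar_vec 2 p q)) +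
    \<i> * (quad_form A (polar_vec 3 p q) - quad_form A (polar_vec 1 p q)))"
    by (simp only: algebra_simps)
  finally show ?thesis
    by (simp only: mult_cancel_left) simp
qed

text \<open>A Jordan integral is known to agree with a functional on bounded measurable functions
  only. The axioms involve no others: the limit \<open>f\<close> inherits the bound
  \<open>K\<close>.\<close>

lemma sigma_functional_cong_fun:
  assumes "sigma_functional M I" and eq: "\<And>f. bounded_measurable M f \<Longrightarrow> J f = I f"
  shows "sigma_functional M J"
  unfolding sigma_functional_def
proof (intro conjI allI impI)
  fix F :: "nat \<Rightarrow> 'a \<Rightarrow> complex" and f K
  assume F: "\<forall>k. F k \<in> borel_measurable M" "\<forall>k. \<forall>x\<in>space M. norm (F k x) \<le> (K::real)"
    "f \<in> borel_measurable M" "\<forall>x\<in>space M. (\<lambda>k. F k x) \<longlonglongrightarrow> f x"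
  have "norm (f x) \<le> K" if "x \<in> space M" for x
    using F that by (intro LIMSEQ_le_const2[OF tendsto_norm[of "\<lambda>k. F k x"]]) auto
  then have "bounded_measurable M f"
    using F by (intro bounded_measurableI) auto
  moreover have "bounded_measurable M (F k)" for k
    using F by (intro bounded_measurableI) auto
  moreover have "(\<lambda>k. I (F k)) \<longlonglongrightarrow> I f"
    using F by (intro sigma_functional_tendsto[OF assms(1), where K = K]) simp_all
  ultimately show "(\<lambda>k. J (F k)) \<longlonglongrightarrow> J f"
    by (simp add: eq)
qed (simp_all add: eq sigma_functional_add[OF assms(1)] sigma_functional_cmult[OF assms(1)]
      bounded_measurable_add bounded_measurable_cmult)

lemma vector_measure_quad_form:
  assumes "vector_measure M \<mu>"
  shows "vector_measure M (\<lambda>A. quad_form (\<lambda>p q. \<mu> A $ p $ q) v)"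
  unfolding vector_measure_def quad_form_def
proof (intro conjI allI impI)
  fix F :: "nat \<Rightarrow> _" assume "range F \<subseteq> sets M" "disjoint_family F"
  then have "(\<lambda>n. \<mu> (F n)) sums \<mu> (\<Union>n. F n)"
    by (rule vector_measure_sums[OF assms])
  then have "(\<lambda>n. \<mu> (F n) $ p $ q) sums (\<mu> (\<Union>n. F n) $ p $ q)" for p q
    by (intro bounded_linear.sums[OF bounded_linear_vec_nth])
  then show "(\<lambda>n. \<Sum>p\<in>UNIV. \<Sum>q\<in>UNIV. cnj (v p) * \<mu> (F n) $ p $ q * v q) sums
      (\<Sum>p\<in>UNIV. \<Sum>q\<in>UNIV. cnj (v p) * \<mu> (\<Union>n. F n) $ p $ q * v q)"
    by (intro sums_sum sums_mult sums_mult2)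
qed (simp add: vector_measure_notin[OF assms])

lemma vector_measure_Re:
  assumes "vector_measure M \<kappa>"
  shows "vector_measure M (\<lambda>A. Re (\<kappa> A))"
  using assms by (auto simp: vector_measure_def intro: sums_Re)

lemma positive_matrix_measure_quad_form:
  assumes "positive_matrix_measure \<mu>"
  obtains N where "finite_measure N" "sets N = sets circle"
    "\<And>A. quad_form (\<lambda>p q. \<mu> A $ p $ q) v = complex_of_real (measure N A)"
proof -
  have \<mu>: "vector_measure circle \<mu>"
    and nn: "\<And>A. A \<in> sets circle \<Longrightarrow> quad_form (\<lambda>p q. \<mu> A $ p $ q) v \<in> \<real>\<^sub>\<ge>\<^sub>0"
    using assms unfolding positive_matrix_measure_def hermitian_psd_UNIV by blast+
  have nn': "quad_form (\<lambda>p q. \<mu> A $ p $ q) v \<in> \<real>\<^sub>\<ge>\<^sub>0" for A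
    using nn vector_measure_notin[OF vector_measure_quad_form[OF \<mu>, of v], of A] by (cases "A \<in> sets circle") auto
  have Re: "0 \<le> Re (quad_form (\<lambda>p q. \<mu> A $ p $ q) v)" for A
    using nn'[of A] by (simp add: complex_nonneg_Reals_iff)
  obtain N where "finite_measure N" "sets N = sets circle"
    "\<And>A. measure N A = Re (quad_form (\<lambda>p q. \<mu> A $ p $ q) v)"
    by (rule nonneg_vector_measure[OF vector_measure_Re[OF vector_measure_quad_form[OF \<mu>, of v]] Re]) blast
  then show ?thesis
    using nn' by (intro that[of N]) (auto simp: complex_nonneg_Reals_iff complex_eq_iff)
qed

text \<open>Polarization makes the entry a combination of four finite measures, so its Jordan
  integral is a sigma-functional. Everything that follows uses only these two facts about the
  integral.\<close>

lemma positive_matrix_measure_entry: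
  assumes "positive_matrix_measure \<mu>"
  shows "sigma_functional circle (complex_measure_integral circle (\<lambda>A. \<mu> A $ p $ q))"
    and "A \<in> sets circle \<Longrightarrow>
      complex_measure_integral circle (\<lambda>A. \<mu> A $ p $ q) (indicator A) = \<mu> A $ p $ q"
proof -
  have "\<exists>N. finite_measure N \<and> sets N = sets circle \<and>
    (\<forall>A. quad_form (\<lambda>p q. \<mu> A $ p $ q) (polar_vec i p q) = complex_of_real (measure N A))" for i
    by (rule positive_matrix_measure_quad_form[OF assms, of "polar_vec i p q"]) blast
  then obtain m where m: "\<And>i. finite_measure (m i)" "\<And>i. sets (m i) = sets circle"
    and quad: "\<And>i A. quad_form (\<lambda>p q. \<mu> A $ p $ q) (polar_vec i p q) = complex_of_real (measure (m i) A)"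
    by metis
  let ?J = "\<lambda>f. ((LINT x|m 0. f x) - (LINT x|m 2. f x)) + \<i> * ((LINT x|m 3. f x) - (LINT x|m 1. f x))"
  have eq: "\<mu> A $ p $ q = complex_of_real (measure (m 0) A - measure (m 2) A) +
      \<i> * complex_of_real (measure (m 3) A - measure (m 1) A)" for A
    by (subst polarization[of "\<lambda>p q. \<mu> A $ p $ q"]) (simp add: quad)
  have J: "complex_measure_integral circle (\<lambda>A. \<mu> A $ p $ q) f = ?J f" if "bounded_measurable circle f" for f
    by (rule complex_measure_integral_combination[OF m eq that])
  have "sigma_functional circle ?J"
    by (intro sigma_functional_plus sigma_functional_scale sigma_functional_diff sigma_functional_integral m)
  then show "sigma_functional circle (complex_measure_integral circle (\<lambda>A. \<mu> A $ p $ q))"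
    by (rule sigma_functional_cong_fun) (rule J)
  show "complex_measure_integral circle (\<lambda>A. \<mu> A $ p $ q) (indicator A) = \<mu> A $ p $ q"
    if "A \<in> sets circle"
    using that by (subst J) (auto simp: eq finite_measure.integral_complex_indicator m)
qed

section \<open>Scalar Herglotz theorem\<close>

lemma integral_mode:
  "integrable lborel (\<lambda>t. indicator {0..2 * pi} t *\<^sub>R mode k t)"
  "(LINT t|lborel. indicator {0..2 * pi} t *\<^sub>R mode k t) = (if k = 0 then 2 * pi else 0)"
proof -
  have "has_bochner_integral lborel (\<lambda>t. indicator {0..2 * pi} t *\<^sub>R mode k t)
      (if k = 0 then 2 * pi else 0)"
  proof (cases "k = 0")
    case True
    have "has_bochner_integral lborel (\<lambda>t. indicator {0..2 * pi} t *\<^sub>R (1::complex))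
        (measure lborel {0..2 * pi} *\<^sub>R 1)"
      by (intro has_bochner_integral_indicator) auto
    then show ?thesis
      using True by (simp add: scaleR_conv_of_real)
  next
    case False
    let ?F = "\<lambda>t. mode k t / (\<i> * of_int k)"
    have "has_bochner_integral lborel (\<lambda>t. indicator {0..2 * pi} t *\<^sub>R mode k t) (?F (2 * pi) - ?F 0)"
    proof (rule has_bochner_integral_FTC_Icc)
      fix t
      have "((\<lambda>t. exp (\<i> * of_int k * complex_of_real t) / (\<i> * of_int k)) has_vector_derivative
          exp (\<i> * of_int k * complex_of_real t)) (at t within {0..2 * pi})"
        using False
        by (auto intro!: derivative_eq_intros has_vector_derivative_real_field simp: field_simps)
      then show "(?F has_vector_derivative mode k t) (at t within {0..2 * pi})"
        by (simp add: mode_def[abs_def])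
    qed (auto intro: continuous_intros)
    moreover have "mode k (2 * pi) = 1"
      using cis_multiple_2pi[of "of_int k"] by (simp add: mode_eq_cis mult.commute mult.left_commute)
    moreover have "mode k 0 = 1"
      by (simp add: mode_def)
    ultimately show ?thesis
      using False by simp
  qed
  then show "integrable lborel (\<lambda>t. indicator {0..2 * pi} t *\<^sub>R mode k t)"
    "(LINT t|lborel. indicator {0..2 * pi} t *\<^sub>R mode k t) = (if k = 0 then 2 * pi else 0)"
    by (auto simp: has_bochner_integral_iff)
qed

text \<open>The \<open>n\<close>-th diagonal of an \<open>N\<close> by \<open>N\<close> matrix has
  \<open>N - |n|\<close> entries, with row indices in
  \<open>{nat (- n)..<N - nat n}\<close>.\<close>

lemma sum_toeplitz_diagonal:
  assumes "\<bar>n\<bar> \<le> int N"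
  shows "(\<Sum>m<N. \<Sum>l<N. if int l - int m = n then c (int l - int m) else 0) =
    of_int (int N - \<bar>n\<bar>) * (c n :: complex)"
proof -
  have "(\<Sum>l<N. if int l - int m = n then c (int l - int m) else 0) =
      (if 0 \<le> int m + n \<and> int m + n < int N then c n else 0)" for m
  proof -
    have "(\<Sum>l<N. if int l - int m = n then c (int l - int m) else 0) =
        (\<Sum>l<N. if l = nat (int m + n) then if 0 \<le> int m + n then c n else 0 else 0)"
      by (intro sum.cong) auto
    then show ?thesis
      by (auto simp: sum.delta)
  qed
  then have "(\<Sum>m<N. \<Sum>l<N. if int l - int m = n then c (int l - int m) else 0) =
      (\<Sum>m\<in>{m \<in> {..<N}. 0 \<le> int m + n \<and> int m + n < int N}. c n)"
    by (simp add: sum.If_cases Int_def)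
  also have "{m \<in> {..<N}. 0 \<le> int m + n \<and> int m + n < int N} = {nat (- n)..<N - nat n}"
    by auto
  finally show ?thesis
    using assms by (cases "n \<ge> 0") auto
qed

text \<open>\<open>D\<close> has a Fejer mean as density, which is nonnegative by \<open>pd\<close>
  at vectors of exponentials. The factor \<open>N - |n|\<close> counts the matrix entries that
  survive orthogonality.\<close>

lemma fejer_measure:
  fixes c :: "int \<Rightarrow> complex"
  assumes pd: "\<And>N v. (\<Sum>m<N. \<Sum>l<N. cnj (v m) * c (int l - int m) * v l) \<in> \<real>\<^sub>\<ge>\<^sub>0" and N: "N > 0"
  obtains D where "finite_measure D" "sets D = sets borel" "AE t in D. t \<in> {0..2 * pi}"
    "\<And>n. \<bar>n\<bar> \<le> int N \<Longrightarrow> (LINT t|D. mode n t) = c n * of_int (int N - \<bar>n\<bar>) / of_nat N"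
proof -
  \<comment> \<open>\<open>F\<close> is the quadratic form of the Toeplitz matrix at the vector \<open>(exp (- i l t))\<close>\<close>
  define F where "F t = (\<Sum>m<N. \<Sum>l<N. c (int l - int m) * mode (int m - int l) t)" for t
  have "F t \<in> \<real>\<^sub>\<ge>\<^sub>0" for t
  proof -
    have "F t = (\<Sum>m<N. \<Sum>l<N. cnj (mode (- int m) t) * c (int l - int m) * mode (- int l) t)"
      unfolding F_def
    proof (intro sum.cong refl)
      fix m l
      have "mode (int m - int l) t = mode (int m) t * mode (- int l) t"
        by (simp add: mode_mult)
      then show "c (int l - int m) * mode (int m - int l) t =
          cnj (mode (- int m) t) * c (int l - int m) * mode (- int l) t"
        by (simp add: cnj_mode)
    qed
    then show ?thesis
      using pd by simp
  qed
  then have F: "0 \<le> Re (F t)" "F t = of_real (Re (F t))" for t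
    by (auto simp: complex_nonneg_Reals_iff complex_eq_iff)
  have F_cont: "continuous_on UNIV F"
    unfolding F_def by (intro continuous_intros)
  \<comment> \<open>The factor 2 pi normalizes the orthogonality integral, \<open>N\<close> the
    averaging.\<close>
  define h where "h t = indicator {0..2 * pi} t * (Re (F t) / (2 * pi * N))" for t
  have h_nonneg: "0 \<le> h t" for t
    using F by (simp add: h_def)
  have [measurable]: "(\<lambda>t. Re (F t)) \<in> borel_measurable borel"
    using F_cont by (intro borel_measurable_continuous_onI continuous_intros)
  have h_meas [measurable]: "h \<in> borel_measurable borel"
    unfolding h_def by measurable
  have mode_meas [measurable]: "mode n \<in> borel_measurable borel" for n
    by (intro borel_measurable_continuous_onI continuous_intros)
  have h_mode: "h t *\<^sub>R mode n t = (\<Sum>m<N. \<Sum>l<N. (c (int l - int m) / (2 * pi * N)) *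
      (indicator {0..2 * pi} t *\<^sub>R mode (int m - int l + n) t))" for n t
  proof -
    have "h t *\<^sub>R mode n t = indicator {0..2 * pi} t *\<^sub>R (F t * mode n t) / (2 * pi * N)"
      by (subst F(2)) (simp add: h_def scaleR_conv_of_real)
    also have "F t * mode n t = (\<Sum>m<N. \<Sum>l<N. c (int l - int m) * mode (int m - int l + n) t)"
      by (simp add: F_def sum_distrib_right mult.assoc mode_mult)
    finally show ?thesis
      by (simp add: scaleR_sum_right sum_divide_distrib)
  qed
  have h_int: "integrable lborel (\<lambda>t. h t *\<^sub>R mode n t)" for n
    unfolding h_mode by (intro Bochner_Integration.integrable_sum integrable_mult_right integral_mode)
  have int: "(LINT t|lborel. h t *\<^sub>R mode n t) = c n * of_int (int N - \<bar>n\<bar>) / of_nat N"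
    if "\<bar>n\<bar> \<le> int N" for n
  proof -
    have "(LINT t|lborel. h t *\<^sub>R mode n t) = (\<Sum>m<N. \<Sum>l<N. (c (int l - int m) / (2 * pi * N)) *
        (LINT t|lborel. indicator {0..2 * pi} t *\<^sub>R mode (int m - int l + n) t))"
      unfolding h_mode
      by (simp only: Bochner_Integration.integral_sum Bochner_Integration.integrable_sum
          integrable_mult_right integral_mode(1) integral_mult_right_zero)
    \<comment> \<open>Orthogonality: \<open>m - l + n\<close> is 0 exactly on the
      \<open>n\<close>-th diagonal.\<close>
    also have "\<dots> = (\<Sum>m<N. \<Sum>l<N. (if int l - int m = n then c (int l - int m) else 0) / N)"
      unfolding integral_mode(2) by (intro sum.cong refl) auto
    also have "\<dots> = c n * of_int (int N - \<bar>n\<bar>) / of_nat N"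
      unfolding sum_divide_distrib[symmetric] sum_toeplitz_diagonal[OF that] by simp
    finally show ?thesis .
  qed
  define D where "D = density lborel (\<lambda>t. ennreal (h t))"
  have int_D: "(LINT t|D. mode n t) = (LINT t|lborel. h t *\<^sub>R mode n t)" for n
    unfolding D_def using h_nonneg by (intro integral_density) auto
  show thesis
  proof (rule that[of D])
    have "integrable D (mode 0)"
      unfolding D_def using h_nonneg h_int[of 0] by (subst integrable_density) auto
    moreover have "mode 0 = (\<lambda>_. 1)"
      by (simp add: fun_eq_iff)
    ultimately have "integrable D (\<lambda>_. 1 :: complex)"
      by simp
    then show "finite_measure D"
      by (intro finite_measureI) (simp add: integrable_iff_bounded less_top)
    show "AE t in D. t \<in> {0..2 * pi}"
      unfolding D_def by (subst AE_density) (auto simp: h_def split: split_indicator)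
    show "(LINT t|D. mode n t) = c n * of_int (int N - \<bar>n\<bar>) / of_nat N" if "\<bar>n\<bar> \<le> int N" for n
      unfolding int_D by (rule int[OF that])
  qed (simp add: D_def)
qed


text \<open>With \<open>c 0 = 1\<close> the Fejer measures are probability measures carried by
  \<open>[0, 2 pi]\<close>, hence tight. Along a weakly convergent subsequence the
  \<open>n\<close>-th coefficient tends to \<open>c n\<close>, because the Fejer factor
  \<open>1 - |n| / Suc k\<close> tends to 1.\<close>

lemma herglotz_normalized:
  fixes c :: "int \<Rightarrow> complex"
  assumes pd: "\<And>N v. (\<Sum>m<N. \<Sum>l<N. cnj (v m) * c (int l - int m) * v l) \<in> \<real>\<^sub>\<ge>\<^sub>0" and c0: "c 0 = 1"
  obtains M where "real_distribution M" "\<And>n. (LINT t|M. mode n t) = c n"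
proof -
  have "\<exists>D. finite_measure D \<and> sets D = sets borel \<and> (AE t in D. t \<in> {0..2 * pi}) \<and>
    (\<forall>n. \<bar>n\<bar> \<le> int (Suc k) \<longrightarrow> (LINT t|D. mode n t) = c n * of_int (int (Suc k) - \<bar>n\<bar>) / of_nat (Suc k))" for k
    using fejer_measure[of c "Suc k", OF pd] by (metis zero_less_Suc)
  then obtain D where D: "\<And>k. finite_measure (D k)" "\<And>k. sets (D k) = sets borel"
    "\<And>k. AE t in D k. t \<in> {0..2 * pi}"
    "\<And>k n. \<bar>n\<bar> \<le> int (Suc k) \<Longrightarrow>
       (LINT t|D k. mode n t) = c n * of_int (int (Suc k) - \<bar>n\<bar>) / of_nat (Suc k)"
    by metis
  have space: "space (D k) = UNIV" for k
    using sets_eq_imp_space_eq[OF D(2)] by simp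
  have prob: "real_distribution (D k)" for k
  proof -
    interpret finite_measure "D k" by (rule D(1))
    have "complex_of_real (measure (D k) (space (D k))) = 1"
      using D(4)[of 0 k] c0 by (simp add: scaleR_conv_of_real del: of_nat_Suc)
    then have "prob_space (D k)"
      by (intro prob_spaceI) (simp add: emeasure_eq_measure)
    then show ?thesis
      using D(2) by (simp add: real_distribution_def real_distribution_axioms_def)
  qed
  \<comment> \<open>Tightness is stated with half-open intervals; the left end -1 keeps a possible
    mass at 0.\<close>
  have mass: "measure (D k) {-1<..2 * pi} = 1" for k
  proof -
    interpret real_distribution "D k" by (rule prob)
    have "AE t in D k. t \<in> {-1<..2 * pi}"
      using D(3)[of k] by eventually_elim auto
    then show ?thesis
      by (subst prob_eq_1) auto
  qed
  have "(-1::real) < 2 * pi"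
    using pi_gt_zero by linarith
  then have "\<exists>a b. a < b \<and> (\<forall>k. 1 - \<epsilon> < measure (D k) {a<..b})" if "0 < \<epsilon>" for \<epsilon> :: real
    using that by - (rule exI[of _ "-1"], rule exI[of _ "2 * pi"], simp add: mass)
  then have "tight D"
    unfolding tight_def using prob by simp
  then obtain r M where r: "strict_mono r" and M: "real_distribution M" and conv: "weak_conv_m (D \<circ> r) M"
    using tight_imp_convergent_subsubsequence[of D id, OF _ strict_mono_id] unfolding comp_id by blast
  have "(LINT t|M. mode n t) = c n" for n
  proof -
    \<comment> \<open>Fourier coefficients are values of the characteristic function at integers, so
      weak convergence passes to them by Levy's theorem.\<close>
    have char: "char A (of_int n) = (LINT t|A. mode n t)" for A
      by (simp add: char_def mode_def mult.assoc)
    have "(\<lambda>k. char (D (r k)) (of_int n)) \<longlonglongrightarrow> char M (of_int n)"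
      using levy_continuity1[OF _ M conv] prob by simp
    moreover have "(\<lambda>k. LINT t|D (r k). mode n t) \<longlonglongrightarrow> c n"
    proof -
      have "(\<lambda>k. c n * of_real (1 - of_int \<bar>n\<bar> * (1 / real (Suc k)))) \<longlonglongrightarrow> c n * of_real (1 - of_int \<bar>n\<bar> * 0)"
        using LIMSEQ_inverse_real_of_nat unfolding inverse_eq_divide
        by (intro tendsto_mult tendsto_const tendsto_of_real tendsto_diff)
      moreover have "\<forall>\<^sub>F k in sequentially.
          c n * of_real (1 - of_int \<bar>n\<bar> * (1 / real (Suc k))) = (LINT t|D k. mode n t)"
        using eventually_ge_at_top[of "nat \<bar>n\<bar>"]
      proof eventually_elim
        case (elim k)
        then show ?case
          by (subst D(4)) (auto simp: field_simps simp del: of_int_abs of_nat_Suc)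
      qed
      ultimately have "(\<lambda>k. LINT t|D k. mode n t) \<longlonglongrightarrow> c n"
        by (auto intro: Lim_transform_eventually)
      from LIMSEQ_subseq_LIMSEQ[OF this r] show ?thesis
        by (simp add: o_def)
    qed
    ultimately show ?thesis
      unfolding char by (rule LIMSEQ_unique)
  qed
  then show thesis
    by (rule that[OF M])
qed

text \<open>The limit measure lives on the real line, where \<open>0\<close> and \<open>2\<pi>\<close> are distinct points.\<close>

definition wrap :: "real \<Rightarrow> real" where
  "wrap t = t - 2 * pi * of_int \<lfloor>t / (2 * pi)\<rfloor>"

lemma wrap_in_circle: "wrap t \<in> {0..<2 * pi}"
  using floor_divide_lower[of "2 * pi" t] floor_divide_upper[of "2 * pi" t]
  by (simp add: wrap_def algebra_simps)

lemma mode_wrap: "mode n (wrap t) = mode n t"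
proof -
  have "mode n (wrap t) = cis (of_int n * t) / cis (2 * pi * of_int (n * \<lfloor>t / (2 * pi)\<rfloor>))"
    unfolding mode_eq_cis cis_divide by (simp add: wrap_def algebra_simps)
  then show ?thesis
    by (simp add: mode_eq_cis cis_multiple_2pi del: of_int_mult)
qed

text \<open>If \<open>c 0\<close> is nonzero, dividing by it reduces to the normalized case. If
  \<open>c 0 = 0\<close>, every Fejer measure has mass 0, so all coefficients vanish.\<close>

lemma herglotz:
  fixes c :: "int \<Rightarrow> complex"
  assumes pd: "\<And>N v. (\<Sum>m<N. \<Sum>l<N. cnj (v m) * c (int l - int m) * v l) \<in> \<real>\<^sub>\<ge>\<^sub>0"
  obtains N where "finite_measure N" "sets N = sets circle" "\<And>n. (LINT t|N. mode n t) = c n"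
proof (cases "c 0 = 0")
  case True
  have "c n = 0" for n
  proof -
    \<comment> \<open>Size \<open>|n| + 1\<close> leaves a nonzero Fejer factor at the
      \<open>n\<close>-th coefficient.\<close>
    obtain D where "finite_measure D" and D: "sets D = sets borel"
      "\<And>k. \<bar>k\<bar> \<le> int (Suc (nat \<bar>n\<bar>)) \<Longrightarrow>
        (LINT t|D. mode k t) = c k * of_int (int (Suc (nat \<bar>n\<bar>)) - \<bar>k\<bar>) / of_nat (Suc (nat \<bar>n\<bar>))"
      by (rule fejer_measure[of c "Suc (nat \<bar>n\<bar>)", OF pd zero_less_Suc]) blast
    interpret finite_measure D by fact
    have "(LINT t|D. mode 0 t) = 0"
      using D(2)[of 0] True by simp
    then have "measure D (space D) = 0"
      by (simp add: scaleR_conv_of_real)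
    moreover have "norm (LINT t|D. mode n t) \<le> (LINT t|D. norm (mode n t))"
      by (rule integral_norm_bound)
    ultimately have "(LINT t|D. mode n t) = 0"
      by simp
    moreover have "complex_of_int (1 + \<bar>n\<bar>) \<noteq> 0"
      by (subst of_int_eq_0_iff) linarith
    ultimately show ?thesis
      using D(2)[of n] by simp
  qed
  then show thesis
    by (intro that[of "null_measure circle"]) (auto intro!: finite_measureI)
next
  case False
  have c0: "c 0 \<in> \<real>\<^sub>\<ge>\<^sub>0"
    using pd[where N = 1 and v = "\<lambda>_. 1"] by simp
  then have c0': "c 0 = of_real (Re (c 0))" "0 < Re (c 0)"
    using False by (auto simp: complex_nonneg_Reals_iff complex_eq_iff)
  define d where "d n = c n / c 0" for n
  have "(\<Sum>m<N. \<Sum>l<N. cnj (v m) * d (int l - int m) * v l) \<in> \<real>\<^sub>\<ge>\<^sub>0" for N v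
  proof -
    have "(\<Sum>m<N. \<Sum>l<N. cnj (v m) * d (int l - int m) * v l) =
        (\<Sum>m<N. \<Sum>l<N. cnj (v m) * c (int l - int m) * v l) / c 0"
      by (simp add: d_def sum_divide_distrib)
    then show ?thesis
      using pd c0 by (simp add: nonneg_Reals_divide_I)
  qed
  moreover have "d 0 = 1"
    using False by (simp add: d_def)
  ultimately obtain M where M: "real_distribution M" "\<And>n. (LINT t|M. mode n t) = d n"
    using herglotz_normalized[of d] by blast
  interpret real_distribution M by fact
  have wrap: "wrap \<in> measurable borel circle"
    unfolding circle_def using wrap_in_circle
    by (intro measurable_restrict_space2) (auto simp: wrap_def[abs_def])
  \<comment> \<open>The density restores the mass \<open>c 0\<close>; pushing forward under
    \<open>wrap\<close> moves 2 pi to 0 and leaves the modes unchanged.\<close>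
  let ?M = "density M (\<lambda>_. ennreal (Re (c 0)))"
  have wrap_M: "wrap \<in> measurable ?M circle"
    using wrap by (simp cong: measurable_cong_sets)
  have mode_meas: "mode n \<in> borel_measurable borel" for n
    by (intro borel_measurable_continuous_onI continuous_intros)
  show thesis
  proof (rule that[of "distr ?M circle wrap"])
    have "finite_measure ?M"
      by (intro finite_measureI) (simp add: emeasure_density ennreal_mult_eq_top_iff emeasure_eq_measure)
    then show "finite_measure (distr ?M circle wrap)"
      using wrap_M by (rule finite_measure.finite_measure_distr)
    fix n
    have "(LINT t|distr ?M circle wrap. mode n t) = (LINT t|?M. mode n (wrap t))"
      using wrap_M measurable_circleI[OF mode_meas] by (intro integral_distr) auto
    also have "\<dots> = (LINT t|M. Re (c 0) *\<^sub>R mode n t)"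
      unfolding mode_wrap using c0' mode_meas by (intro integral_density) auto
    also have "\<dots> = c n"
      using M(2) False c0'(1) by (simp add: d_def scaleR_conv_of_real)
    finally show "(LINT t|distr ?M circle wrap. mode n t) = c n" .
  qed simp
qed

section \<open>Matrix-valued Herglotz theorem\<close>

definition fourier_coeffs ::
  "(real set \<Rightarrow> complex^'m^'m) \<Rightarrow> (int \<Rightarrow> complex^'m^'m) \<Rightarrow> bool" where
  "fourier_coeffs \<mu> c \<longleftrightarrow>
     (\<forall>n p q. complex_measure_integral circle (\<lambda>A. \<mu> A $ p $ q) (mode n) = c n $ p $ q)"

lemma positive_matrix_measure_notin:
  "positive_matrix_measure \<mu> \<Longrightarrow> A \<notin> sets circle \<Longrightarrow> \<mu> A = 0"
  unfolding positive_matrix_measure_def by (elim conjE) (rule vector_measure_notin)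

lemma positive_matrix_measure_hermitian:
  assumes "positive_matrix_measure \<mu>" "A \<in> sets circle"
  shows "cnj (\<mu> A $ p $ q) = \<mu> A $ q $ p"
proof -
  have "\<forall>p q. \<mu> A $ q $ p = cnj (\<mu> A $ p $ q)"
    using assms unfolding positive_matrix_measure_def hermitian_psd_UNIV by blast
  then show ?thesis
    by (rule allE[where x = p]) (erule allE[where x = q], erule sym)
qed

lemma positive_matrix_measure_unique:
  assumes "positive_matrix_measure \<mu>" "positive_matrix_measure \<mu>'"
    and "fourier_coeffs \<mu> c" "fourier_coeffs \<mu>' c"
  shows "\<mu> = \<mu>'"
proof
  fix A
  show "\<mu> A = \<mu>' A"
  proof (cases "A \<in> sets circle")
    case True
    have "\<mu> A $ p $ q = \<mu>' A $ p $ q" for p q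
      using sigma_functional_mode_eqI[OF positive_matrix_measure_entry(1)[OF assms(1), of p q]
          positive_matrix_measure_entry(1)[OF assms(2), of p q] _ bounded_measurable_indicator[OF True]]
        assms(3,4) True
      by (simp add: positive_matrix_measure_entry(2)[OF assms(1)] positive_matrix_measure_entry(2)[OF assms(2)]
          fourier_coeffs_def)
    then show ?thesis
      by (simp add: vec_eq_iff)
  qed (simp add: positive_matrix_measure_notin assms)
qed

text \<open>Conjugating a Hermitian matrix measure transposes it, and conjugating a mode negates its
  frequency.\<close>

lemma fourier_coeffs_cnj:
  assumes "positive_matrix_measure \<mu>" "fourier_coeffs \<mu> c"
  shows "cnj (c n $ p $ q) = c (- n) $ q $ p"
proof -
  let ?I = "\<lambda>p q. complex_measure_integral circle (\<lambda>A. \<mu> A $ p $ q)"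
  have "cnj (?I p q (\<lambda>x. cnj (mode (- n) (id x)))) = ?I q p (mode (- n))"
  proof (rule sigma_functional_eqI[where M = circle and J = "?I q p"
        and I = "\<lambda>f. cnj (?I p q (\<lambda>x. cnj (f (id x))))"])
    fix A assume A: "A \<in> sets circle"
    have "(\<lambda>x. cnj (indicator A (id x))) = (indicator A :: _ \<Rightarrow> complex)"
      by (auto simp: indicator_def)
    then show "cnj (?I p q (\<lambda>x. cnj (indicator A (id x)))) = ?I q p (indicator A)"
      using A by (simp add: positive_matrix_measure_entry(2)[OF assms(1)] positive_matrix_measure_hermitian[OF assms(1)])
  qed (auto intro!: sigma_functional_cnj positive_matrix_measure_entry assms)
  then show ?thesis
    using assms(2) by (simp add: cnj_mode fourier_coeffs_def)
qed

lemma nonneg_Reals_sum: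
  "(\<And>x. x \<in> X \<Longrightarrow> f x \<in> \<real>\<^sub>\<ge>\<^sub>0) \<Longrightarrow> (\<Sum>x\<in>X. f x) \<in> \<real>\<^sub>\<ge>\<^sub>0"
  by (induction X rule: infinite_finite_induct) (auto intro: nonneg_Reals_add_I)

lemma sum_swap_pairs:
  "(\<Sum>a\<in>A. \<Sum>b\<in>B. \<Sum>m\<in>M. \<Sum>l\<in>L. g a b m l) = (\<Sum>m\<in>M. \<Sum>l\<in>L. \<Sum>a\<in>A. \<Sum>b\<in>B. g a b m l)"
proof -
  have "(\<Sum>a\<in>A. \<Sum>b\<in>B. \<Sum>m\<in>M. \<Sum>l\<in>L. g a b m l) = (\<Sum>a\<in>A. \<Sum>m\<in>M. \<Sum>b\<in>B. \<Sum>l\<in>L. g a b m l)"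
    by (rule sum.cong[OF refl]) (rule sum.swap)
  also have "\<dots> = (\<Sum>m\<in>M. \<Sum>a\<in>A. \<Sum>b\<in>B. \<Sum>l\<in>L. g a b m l)"
    by (rule sum.swap)
  also have "\<dots> = (\<Sum>m\<in>M. \<Sum>a\<in>A. \<Sum>l\<in>L. \<Sum>b\<in>B. g a b m l)"
    by (rule sum.cong[OF refl], rule sum.cong[OF refl]) (rule sum.swap)
  also have "\<dots> = (\<Sum>m\<in>M. \<Sum>l\<in>L. \<Sum>a\<in>A. \<Sum>b\<in>B. g a b m l)"
    by (rule sum.cong[OF refl]) (rule sum.swap)
  finally show ?thesis .
qed

text \<open>The scalars may be noncommutative and \<open>cj\<close> is free, so that this serves
  both the quaternionic and the complex Toeplitz matrices.\<close>

lemma block_toeplitz_quad_form: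
  fixes c :: "int \<Rightarrow> ('a::semiring_0)^'m^'m"
  shows "(\<Sum>p\<in>J \<times> UNIV. \<Sum>q\<in>J \<times> UNIV. cj (v p) * block_toeplitz c p q * v q) =
    (\<Sum>m\<in>J. \<Sum>l\<in>J. \<Sum>a\<in>UNIV. \<Sum>b\<in>UNIV. cj (v (m, a)) * c (int l - int m) $ a $ b * v (l, b))"
proof -
  have "(\<Sum>p\<in>J \<times> UNIV. \<Sum>q\<in>J \<times> UNIV. cj (v p) * block_toeplitz c p q * v q) =
      (\<Sum>m\<in>J. \<Sum>a\<in>UNIV. \<Sum>l\<in>J. \<Sum>b\<in>UNIV. cj (v (m, a)) * c (int l - int m) $ a $ b * v (l, b))"
    unfolding sum.cartesian_product' by (simp add: block_toeplitz_def)
  also have "\<dots> = (\<Sum>m\<in>J. \<Sum>l\<in>J. \<Sum>a\<in>UNIV. \<Sum>b\<in>UNIV. cj (v (m, a)) * c (int l - int m) $ a $ b * v (l, b))"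
    by (intro sum.cong refl) (rule sum.swap)
  finally show ?thesis .
qed

text \<open>Formally the quadratic form is the integral of \<open>w(t)* d\<mu>(t) w(t)\<close>,
  where \<open>w(t)\<close> is the sum of the \<open>v_m e^(imt)\<close>. It is reached as a limit
  of finite sums over level sets, each term being a quadratic form of some
  \<open>\<mu> (B y)\<close>.\<close>

lemma fourier_coeffs_positive:
  assumes "positive_matrix_measure \<mu>" "fourier_coeffs \<mu> c"
  shows "hermitian_psd cnj ({0..N} \<times> UNIV) (block_toeplitz c)"
  unfolding hermitian_psd_def
proof (intro conjI ballI allI)
  show "block_toeplitz c q p = cnj (block_toeplitz c p q)" for p q
    by (cases p; cases q) (simp add: block_toeplitz_def fourier_coeffs_cnj[OF assms])
next
  fix v
  let ?I = "\<lambda>p q. complex_measure_integral circle (\<lambda>A. \<mu> A $ p $ q)"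
  note I = positive_matrix_measure_entry[OF assms(1)]
  \<comment> \<open>The variable itself is approximated, not the modes: one simple function then
    serves all frequencies at once.\<close>
  have "(\<lambda>t. t) \<in> borel_measurable circle"
    by (intro measurable_circleI) simp
  from borel_measurable_implies_sequence_metric[OF this, of 0]
  obtain s where s: "\<forall>i. simple_function circle (s i)" "\<forall>t\<in>space circle. (\<lambda>i. s i t) \<longlonglongrightarrow> t"
      "\<forall>i. \<forall>t\<in>space circle. dist (s i t) 0 \<le> 2 * dist t 0"
    by (elim exE conjE)
  \<comment> \<open>replacing \<open>t\<close> by a simple function \<open>s i\<close> turns the integrals into finite sums of quadratic forms\<close>
  define S where "S i = (\<Sum>m\<in>{0..N}. \<Sum>l\<in>{0..N}. \<Sum>a\<in>UNIV. \<Sum>b\<in>UNIV.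
      cnj (v (m, a)) * ?I a b (\<lambda>t. mode (int l - int m) (s i t)) * v (l, b))" for i
  have lim: "S \<longlonglongrightarrow> (\<Sum>m\<in>{0..N}. \<Sum>l\<in>{0..N}. \<Sum>a\<in>UNIV. \<Sum>b\<in>UNIV.
      cnj (v (m, a)) * c (int l - int m) $ a $ b * v (l, b))"
  proof -
    have lim_I: "(\<lambda>i. ?I a b (\<lambda>t. mode n (s i t))) \<longlonglongrightarrow> c n $ a $ b" for a b n
    proof -
      have "(\<lambda>i. ?I a b (\<lambda>t. mode n (s i t))) \<longlonglongrightarrow> ?I a b (mode n)"
      proof (rule sigma_functional_tendsto[OF I(1), where K = 1])
        show "(\<lambda>t. mode n (s i t)) \<in> borel_measurable circle" for i
          by (rule borel_measurable_simple_function[OF simple_function_compose1[where f = "s i", OF s(1)[rule_format]]])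
        show "(\<lambda>i. mode n (s i t)) \<longlonglongrightarrow> mode n t" if "t \<in> space circle" for t
          by (rule continuous_on_tendsto_compose[OF continuous_on_mode[of UNIV n] s(2)[rule_format, OF that]]) auto
      qed simp
      then show ?thesis
        using assms(2) by (simp add: fourier_coeffs_def)
    qed
    show ?thesis
      unfolding S_def by (intro tendsto_sum tendsto_mult tendsto_const lim_I)
  qed
  have S_nonneg: "S i \<in> \<real>\<^sub>\<ge>\<^sub>0" for i
  proof -
    define Y where "Y = s i ` space circle"
    define B where "B y = s i -` {y} \<inter> space circle" for y
    have B: "B y \<in> sets circle" for y
      using s(1) by (auto simp: B_def intro: simple_functionD)
    \<comment> \<open>The trigonometric polynomial with coefficient vectors from \<open>v\<close>,
      at the value \<open>y\<close> of the simple function.\<close>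
    define w where "w y a = (\<Sum>m\<in>{0..N}. v (m, a) * mode (int m) y)" for y a
    have I_simple: "?I a b (\<lambda>t. mode n (s i t)) = (\<Sum>y\<in>Y. mode n y * \<mu> (B y) $ a $ b)" for a b n
      using sigma_functional_simple[where s = "s i" and f = "mode n", OF I(1)] s(1) I(2)[OF B] by (simp add: Y_def B_def)
    have "S i = (\<Sum>m\<in>{0..N}. \<Sum>l\<in>{0..N}. \<Sum>a\<in>UNIV. \<Sum>b\<in>UNIV. \<Sum>y\<in>Y.
        cnj (v (m, a) * mode (int m) y) * \<mu> (B y) $ a $ b * (v (l, b) * mode (int l) y))"
      unfolding S_def I_simple sum_distrib_left sum_distrib_right
    proof (intro sum.cong refl)
      fix m l a b y
      have "mode (int l - int m) y = cnj (mode (int m) y) * mode (int l) y"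
        by (simp add: cnj_mode mode_mult)
      then show "cnj (v (m, a)) * (mode (int l - int m) y * \<mu> (B y) $ a $ b) * v (l, b) =
          cnj (v (m, a) * mode (int m) y) * \<mu> (B y) $ a $ b * (v (l, b) * mode (int l) y)"
        by simp
    qed
    also have "\<dots> = (\<Sum>y\<in>Y. quad_form (\<lambda>a b. \<mu> (B y) $ a $ b) (w y))"
    proof -
      have "quad_form (\<lambda>a b. \<mu> (B y) $ a $ b) (w y) = (\<Sum>m\<in>{0..N}. \<Sum>l\<in>{0..N}. \<Sum>a\<in>UNIV. \<Sum>b\<in>UNIV.
          cnj (v (m, a) * mode (int m) y) * \<mu> (B y) $ a $ b * (v (l, b) * mode (int l) y))" for y
      proof -
        have "quad_form (\<lambda>a b. \<mu> (B y) $ a $ b) (w y) = (\<Sum>a\<in>UNIV. \<Sum>b\<in>UNIV. \<Sum>m\<in>{0..N}. \<Sum>l\<in>{0..N}.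
            cnj (v (m, a) * mode (int m) y) * \<mu> (B y) $ a $ b * (v (l, b) * mode (int l) y))"
          by (simp add: quad_form_def w_def sum_distrib_left sum_distrib_right)
            (rule sum.cong[OF refl], rule sum.cong[OF refl], rule sum.swap)
        also have "\<dots> = (\<Sum>m\<in>{0..N}. \<Sum>l\<in>{0..N}. \<Sum>a\<in>UNIV. \<Sum>b\<in>UNIV.
            cnj (v (m, a) * mode (int m) y) * \<mu> (B y) $ a $ b * (v (l, b) * mode (int l) y))"
          by (rule sum_swap_pairs)
        finally show ?thesis .
      qed
      then show ?thesis
        by (simp only: sum.swap[of _ Y])
    qed
    finally have S_eq: "S i = (\<Sum>y\<in>Y. quad_form (\<lambda>a b. \<mu> (B y) $ a $ b) (w y))" .
    have "quad_form (\<lambda>a b. \<mu> (B y) $ a $ b) (w y) \<in> \<real>\<^sub>\<ge>\<^sub>0" for y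
      using assms(1) B[of y] unfolding positive_matrix_measure_def hermitian_psd_UNIV by blast
    then show ?thesis
      unfolding S_eq by (intro nonneg_Reals_sum)
  qed
  show "(\<Sum>p\<in>{0..N} \<times> UNIV. \<Sum>q\<in>{0..N} \<times> UNIV. cnj (v p) * block_toeplitz c p q * v q) \<in> \<real>\<^sub>\<ge>\<^sub>0"
    unfolding block_toeplitz_quad_form
    by (rule Lim_in_closed_set[OF closed_nonneg_Reals_complex always_eventually[OF allI[OF S_nonneg]] _ lim]) simp
qed

lemma sums_vecI:
  fixes f :: "nat \<Rightarrow> 'a::real_normed_vector^'n"
  assumes "\<And>i. (\<lambda>n. f n $ i) sums (s $ i)"
  shows "f sums s"
  using assms by (auto simp: sums_def intro!: vec_tendstoI)

text \<open>The vector with entries \<open>u m * v a\<close> turns the block Toeplitz form into the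
  scalar Toeplitz form of the sequence \<open>v* c(n) v\<close>.\<close>

lemma herglotz_quad_form:
  fixes c :: "int \<Rightarrow> complex^'m^'m"
  assumes psd: "\<And>N. hermitian_psd cnj ({0..N} \<times> UNIV) (block_toeplitz c)"
  obtains M where "finite_measure M" "sets M = sets circle"
    "\<And>n. (LINT t|M. mode n t) = quad_form (\<lambda>p q. c n $ p $ q) v"
proof (rule herglotz)
  fix N and u :: "nat \<Rightarrow> complex"
  show "(\<Sum>m<N. \<Sum>l<N. cnj (u m) * quad_form (\<lambda>p q. c (int l - int m) $ p $ q) v * u l) \<in> \<real>\<^sub>\<ge>\<^sub>0"
  proof (cases N)
    case (Suc K)
    define w where "w = (\<lambda>(m, a). u m * v a)"
    have "(\<Sum>p\<in>{0..K} \<times> UNIV. \<Sum>q\<in>{0..K} \<times> UNIV. cnj (w p) * block_toeplitz c p q * w q) \<in> \<real>\<^sub>\<ge>\<^sub>0"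
      using psd[of K] unfolding hermitian_psd_def by blast
    then have "(\<Sum>m\<in>{0..K}. \<Sum>l\<in>{0..K}. \<Sum>a\<in>UNIV. \<Sum>b\<in>UNIV.
        cnj (u m * v a) * c (int l - int m) $ a $ b * (u l * v b)) \<in> \<real>\<^sub>\<ge>\<^sub>0"
      unfolding block_toeplitz_quad_form w_def case_prod_conv .
    moreover have "{..<N} = {0..K}"
      using Suc by auto
    ultimately show ?thesis
      by (simp add: quad_form_def sum_distrib_left sum_distrib_right mult_ac)
  qed simp
qed (rule that)

text \<open>The \<open>M v\<close> come from separate applications of the scalar theorem, while the
  entries of \<open>\<mu>\<close> use only those at polarization vectors. That
  \<open>v* \<mu> v\<close> is \<open>M v\<close> for every \<open>v\<close>, whence positivity,
  holds because both have the same Fourier coefficients.\<close>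

lemma fourier_coeffs_exist:
  fixes c :: "int \<Rightarrow> complex^'m^'m"
  assumes psd: "\<And>N. hermitian_psd cnj ({0..N} \<times> UNIV) (block_toeplitz c)"
  obtains \<mu> where "positive_matrix_measure \<mu>" "fourier_coeffs \<mu> c"
proof -
  have c_cnj: "cnj (c n $ p $ q) = c (- n) $ q $ p" for n p q
  proof -
    have nonneg: "cnj (c (int k) $ p $ q) = c (- int k) $ q $ p" for k p q
    proof -
      have "\<forall>x\<in>{0..k} \<times> UNIV. \<forall>y\<in>{0..k} \<times> UNIV. block_toeplitz c y x = cnj (block_toeplitz c x y)"
        using psd[of k] unfolding hermitian_psd_def by (rule conjunct1)
      \<comment> \<open>Blocks 0 and \<open>k\<close> are compared: the lag is \<open>k\<close> one
        way and \<open>- k\<close> the other.\<close>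
      from bspec[OF bspec[OF this, of "(0, p)"], of "(k, q)"] show ?thesis
        by (simp add: block_toeplitz_def)
    qed
    show ?thesis
    proof (cases "n \<ge> 0")
      case True
      then show ?thesis using nonneg[of "nat n"] by simp
    next
      case False
      then have "cnj (c (- n) $ q $ p) = c n $ p $ q"
        using nonneg[of "nat (- n)" q p] by simp
      then show ?thesis
        by (metis complex_cnj_cnj)
    qed
  qed
  have "\<exists>M. finite_measure M \<and> sets M = sets circle \<and>
      (\<forall>n. (LINT t|M. mode n t) = quad_form (\<lambda>p q. c n $ p $ q) v)" for v
    by (rule herglotz_quad_form[OF psd, of v]) blast
  then obtain M where M: "\<And>v. finite_measure (M v)" "\<And>v. sets (M v) = sets circle"
    "\<And>v n. (LINT t|M v. mode n t) = quad_form (\<lambda>p q. c n $ p $ q) v"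
    by metis
  define J where "J v f = (LINT t|M v. f t)" for v and f :: "real \<Rightarrow> complex"
  have J: "sigma_functional circle (J v)" for v
    unfolding J_def by (intro sigma_functional_integral M)
  define I where "I p q f = (J (polar_vec 0 p q) f - J (polar_vec 2 p q) f) +
    \<i> * (J (polar_vec 3 p q) f - J (polar_vec 1 p q) f)" for p q and f :: "real \<Rightarrow> complex"
  have I: "sigma_functional circle (I p q)" for p q
    unfolding I_def by (intro sigma_functional_plus sigma_functional_scale sigma_functional_diff J)
  have I_mode: "I p q (mode n) = c n $ p $ q" for p q n
    using polarization[of "\<lambda>p q. c n $ p $ q" p q] by (simp add: I_def J_def M)
  define \<mu> where "\<mu> A = (\<chi> p q. if A \<in> sets circle then I p q (indicator A) else 0)" for A
  have \<mu>_entry: "\<mu> A $ p $ q = I p q (indicator A)" if "A \<in> sets circle" for A p q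
    using that by (simp add: \<mu>_def)
  have "vector_measure circle \<mu>"
    unfolding vector_measure_def
  proof (intro conjI allI impI)
    fix F :: "nat \<Rightarrow> real set" assume F: "range F \<subseteq> sets circle" "disjoint_family F"
    then have "F n \<in> sets circle" "(\<Union>n. F n) \<in> sets circle" for n
      by auto
    then show "(\<lambda>n. \<mu> (F n)) sums \<mu> (\<Union>n. F n)"
      using sigma_functional_sums_indicator[OF I F] by (intro sums_vecI) (simp only: \<mu>_entry)
  qed (simp add: \<mu>_def vec_eq_iff)
  moreover have "\<mu> A $ q $ p = cnj (\<mu> A $ p $ q)" if A: "A \<in> sets circle" for A p q
  proof -
    have "cnj (I p q (\<lambda>x. cnj (indicator A (id x)))) = I q p (indicator A)"
    proof (rule sigma_functional_mode_eqI[where I = "\<lambda>f. cnj (I p q (\<lambda>x. cnj (f (id x))))"])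
      show "cnj (I p q (\<lambda>x. cnj (mode n (id x)))) = I q p (mode n)" for n
        by (simp add: cnj_mode I_mode c_cnj)
    qed (use A in \<open>auto intro: sigma_functional_cnj I\<close>)
    moreover have "(\<lambda>x. cnj (indicator A (id x))) = (indicator A :: _ \<Rightarrow> complex)"
      by (auto simp: indicator_def)
    ultimately show ?thesis
      using A by (simp add: \<mu>_entry)
  qed
  moreover have "quad_form (\<lambda>p q. \<mu> A $ p $ q) v \<in> \<real>\<^sub>\<ge>\<^sub>0" if A: "A \<in> sets circle" for A v
  proof -
    have "(\<Sum>p\<in>UNIV. \<Sum>q\<in>UNIV. cnj (v p) * v q * I p q (indicator A)) = J v (indicator A)"
    proof (rule sigma_functional_mode_eqI[where J = "J v" and
          I = "\<lambda>f. (\<Sum>p\<in>UNIV. \<Sum>q\<in>UNIV. cnj (v p) * v q * I p q f)"])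
      show "sigma_functional circle (\<lambda>f. (\<Sum>p\<in>UNIV. \<Sum>q\<in>UNIV. cnj (v p) * v q * I p q f))"
        by (intro sigma_functional_sum_fun sigma_functional_scale I)
      show "(\<Sum>p\<in>UNIV. \<Sum>q\<in>UNIV. cnj (v p) * v q * I p q (mode n)) = J v (mode n)" for n
        by (simp add: I_mode J_def M quad_form_def mult_ac)
    qed (use A J in auto)
    then have "quad_form (\<lambda>p q. \<mu> A $ p $ q) v = of_real (measure (M v) A)"
      using A by (simp add: quad_form_def \<mu>_entry J_def mult_ac M finite_measure.integral_complex_indicator)
    then show ?thesis
      by simp
  qed
  ultimately have pos: "positive_matrix_measure \<mu>"
    unfolding positive_matrix_measure_def hermitian_psd_UNIV by blast
  have "fourier_coeffs \<mu> c"
    unfolding fourier_coeffs_def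
  proof (intro allI)
    fix n p q
    have "complex_measure_integral circle (\<lambda>A. \<mu> A $ p $ q) (mode n) = I p q (mode n)"
      by (rule sigma_functional_eqI[OF positive_matrix_measure_entry(1)[OF pos] I])
        (simp_all add: positive_matrix_measure_entry(2)[OF pos] \<mu>_entry)
    then show "complex_measure_integral circle (\<lambda>A. \<mu> A $ p $ q) (mode n) = c n $ p $ q"
      by (simp add: I_mode)
  qed
  with pos show thesis
    by (rule that)
qed

section \<open>Quaternionic matrices as complex matrices of twice the size\<close>

lemma cparts_arith [simp]:
  "cpart1 0 = 0" "cpart2 0 = 0"
  "cpart1 (x + y) = cpart1 x + cpart1 y" "cpart2 (x + y) = cpart2 x + cpart2 y"
  "cpart1 (qcnj x) = cnj (cpart1 x)" "cpart2 (qcnj x) = - cpart2 x"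
  "cpart1 (quat_of_complex z) = z" "cpart2 (quat_of_complex z) = 0"
  "cpart1 (quat_of_complex w * quat_j) = 0" "cpart2 (quat_of_complex w * quat_j) = w"
  by (simp_all add: cpart1_def cpart2_def zero_quat_def plus_quat_def times_quat_def qcnj_def
      quat_of_complex_def quat_j_def complex_eq_iff)

lemma cpart1_mult: "cpart1 (x * y) = cpart1 x * cpart1 y - cpart2 x * cnj (cpart2 y)"
  and cpart2_mult: "cpart2 (x * y) = cpart1 x * cpart2 y + cpart2 x * cnj (cpart1 y)"
  by (simp_all add: cpart1_def cpart2_def times_quat_def complex_eq_iff)

lemma quat_eq_cparts: "x = y \<longleftrightarrow> cpart1 x = cpart1 y \<and> cpart2 x = cpart2 y"
  by (simp add: cpart1_def cpart2_def quat_eq_iff)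

lemma cpart1_sum: "cpart1 (\<Sum>x\<in>X. f x) = (\<Sum>x\<in>X. cpart1 (f x))"
  by (induction X rule: infinite_finite_induct) simp_all

lemma cpart2_sum: "cpart2 (\<Sum>x\<in>X. f x) = (\<Sum>x\<in>X. cpart2 (f x))"
  by (induction X rule: infinite_finite_induct) simp_all

lemma quat_nonneg_Reals_iff: "x \<in> \<real>\<^sub>\<ge>\<^sub>0 \<longleftrightarrow> cpart1 x \<in> \<real>\<^sub>\<ge>\<^sub>0 \<and> cpart2 x = 0"
proof
  assume "x \<in> \<real>\<^sub>\<ge>\<^sub>0"
  then obtain r where "x = of_real r" "r \<ge> 0"
    by (rule nonneg_Reals_cases)
  then show "cpart1 x \<in> \<real>\<^sub>\<ge>\<^sub>0 \<and> cpart2 x = 0"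
    by (simp add: of_real_def scaleR_quat_def one_quat_def cpart1_def cpart2_def complex_eq_iff
        complex_nonneg_Reals_iff)
next
  assume *: "cpart1 x \<in> \<real>\<^sub>\<ge>\<^sub>0 \<and> cpart2 x = 0"
  then have "x = of_real (q1 x)"
    by (simp add: of_real_def scaleR_quat_def one_quat_def cpart1_def cpart2_def complex_eq_iff
        complex_nonneg_Reals_iff quat_eq_iff)
  moreover have "q1 x \<ge> 0"
    using * by (simp add: cpart1_def complex_nonneg_Reals_iff)
  ultimately show "x \<in> \<real>\<^sub>\<ge>\<^sub>0"
    by (metis nonneg_Reals_of_real_iff)
qed

lemma sum_UNIV_sum_type:
  fixes f :: "'a::finite + 'b::finite \<Rightarrow> 'c::comm_monoid_add"
  shows "(\<Sum>x\<in>UNIV. f x) = (\<Sum>a\<in>UNIV. f (Inl a)) + (\<Sum>b\<in>UNIV. f (Inr b))"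
  unfolding UNIV_Plus_UNIV[symmetric] by (subst sum.Plus) (simp_all add: o_def)

lemma block_matrix_simps [simp]:
  "block_matrix A B C D $ Inl a $ Inl b = A $ a $ b"
  "block_matrix A B C D $ Inl a $ Inr b = B $ a $ b"
  "block_matrix A B C D $ Inr a $ Inl b = C $ a $ b"
  "block_matrix A B C D $ Inr a $ Inr b = D $ a $ b"
  by (simp_all add: block_matrix_def)

lemma mat_simps [simp]:
  "mat_cpart1 P $ a $ b = cpart1 (P $ a $ b)" "mat_cpart2 P $ a $ b = cpart2 (P $ a $ b)"
  "mat_cnj C $ a $ b = cnj (C $ a $ b)" "mat_adj C $ a $ b = cnj (C $ b $ a)"
  by (simp_all add: mat_cpart1_def mat_cpart2_def mat_cnj_def mat_adj_def transpose_def)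

text \<open>The usual embedding of quaternionic matrices as a real algebra with involution. Its
  lower left block is not an adjoint as in \<open>associated_measure\<close>; for Fourier
  coefficients the symmetry of \<open>\<nu>2\<close> reconciles the two.\<close>

definition complexify :: "quat^'s^'s \<Rightarrow> complex^('s + 's)^('s + 's)" where
  "complexify P = block_matrix (mat_cpart1 P) (mat_cpart2 P) (- mat_cnj (mat_cpart2 P)) (mat_cnj (mat_cpart1 P))"

lemma complexify_simps [simp]:
  "complexify P $ Inl a $ Inl b = cpart1 (P $ a $ b)"
  "complexify P $ Inl a $ Inr b = cpart2 (P $ a $ b)"
  "complexify P $ Inr a $ Inl b = - cnj (cpart2 (P $ a $ b))"
  "complexify P $ Inr a $ Inr b = cnj (cpart1 (P $ a $ b))"
  by (simp_all add: complexify_def)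

text \<open>The first column of the complex \<open>2 \<times> 2\<close> matrix that represents a quaternion.\<close>

definition complex_column :: "(nat \<times> 's \<Rightarrow> quat) \<Rightarrow> nat \<times> ('s + 's) \<Rightarrow> complex" where
  "complex_column v = (\<lambda>(m, x). case x of Inl a \<Rightarrow> cpart1 (v (m, a)) | Inr a \<Rightarrow> - cnj (cpart2 (v (m, a))))"

text \<open>The column \<open>(z, - cnj w)\<close> determines \<open>z + w j\<close>, so testing a
  form on all quaternionic vectors amounts to testing one on all complex vectors of twice the
  length.\<close>

lemma complex_column_surj: "\<exists>v. u = complex_column v"
proof -
  let ?v = "\<lambda>(m, a). quat_of_complex (u (m, Inl a)) + quat_of_complex (- cnj (u (m, Inr a))) * quat_j"
  have *: "u (m, x) = complex_column ?v (m, x)" for m x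
    by (cases x) (simp_all add: complex_column_def)
  show ?thesis
    by (rule exI[of _ ?v], rule ext, simp only: split_paired_all, rule *)
qed

lemma all_complex_column: "(\<forall>v. P (complex_column v)) \<longleftrightarrow> (\<forall>u. P u)"
  by (metis complex_column_surj)

text \<open>\<open>cpart1\<close> is the upper left entry of the 2 by 2 matrix of a quaternion, and
  the upper left entry of \<open>V* C V\<close> involves only the first column of
  \<open>V\<close>.\<close>

lemma cpart1_quad_form:
  fixes r :: "int \<Rightarrow> quat^'s^'s" and v :: "nat \<times> 's \<Rightarrow> quat"
  shows "cpart1 (\<Sum>p\<in>J \<times> UNIV. \<Sum>q\<in>J \<times> UNIV. qcnj (v p) * block_toeplitz r p q * v q) =
    (\<Sum>p\<in>J \<times> UNIV. \<Sum>q\<in>J \<times> UNIV. cnj (complex_column v p) *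
      block_toeplitz (\<lambda>n. complexify (r n)) p q * complex_column v q)"
  unfolding block_toeplitz_quad_form cpart1_sum sum_UNIV_sum_type
  by (intro sum.cong refl)
    (simp add: complex_column_def cpart1_mult cpart2_mult sum.distrib[symmetric] algebra_simps)

text \<open>The form of a Hermitian quaternionic matrix equals its own conjugate, so its
  \<open>j\<close>-part vanishes; what remains, \<open>cpart1\<close>, is the complex form.\<close>

lemma positive_definite_iff_complexify:
  fixes r :: "int \<Rightarrow> quat^'s^'s"
  shows "positive_definite r \<longleftrightarrow>
    (\<forall>N. hermitian_psd cnj ({0..N} \<times> UNIV) (block_toeplitz (\<lambda>n. complexify (r n))))"
  unfolding positive_definite_def
proof (intro iff_allI)
  fix N :: nat
  let ?J = "{0..N}" and ?C = "\<lambda>n. complexify (r n)"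
  have herm: "(\<forall>p\<in>?J \<times> UNIV. \<forall>q\<in>?J \<times> UNIV. block_toeplitz r q p = qcnj (block_toeplitz r p q)) \<longleftrightarrow>
      (\<forall>p\<in>?J \<times> UNIV. \<forall>q\<in>?J \<times> UNIV. block_toeplitz ?C q p = cnj (block_toeplitz ?C p q))"
    (is "?H \<longleftrightarrow> ?HC")
  proof
    assume H: ?H
    have r: "r (int m - int l) $ b $ a = qcnj (r (int l - int m) $ a $ b)" if "m \<in> ?J" "l \<in> ?J" for m l a b
      using bspec[OF bspec[OF H, of "(m, a)"], of "(l, b)"] that by (simp add: block_toeplitz_def)
    show ?HC
    proof (intro ballI)
      fix p q :: "nat \<times> ('s + 's)" assume "p \<in> ?J \<times> UNIV" "q \<in> ?J \<times> UNIV"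
      then obtain m x l y where pq: "p = (m, x)" "q = (l, y)" "m \<in> ?J" "l \<in> ?J"
        by auto
      show "block_toeplitz ?C q p = cnj (block_toeplitz ?C p q)"
        unfolding pq(1,2) block_toeplitz_def case_prod_conv
        by (cases x; cases y) (simp_all add: r[OF pq(3,4)])
    qed
  next
    assume H: ?HC
    have C: "?C (int m - int l) $ y $ x = cnj (?C (int l - int m) $ x $ y)" if "m \<in> ?J" "l \<in> ?J" for m l x y
      using bspec[OF bspec[OF H, of "(m, x)"], of "(l, y)"] that by (simp add: block_toeplitz_def)
    show ?H
    proof (intro ballI)
      fix p q :: "nat \<times> 's" assume "p \<in> ?J \<times> UNIV" "q \<in> ?J \<times> UNIV"
      then obtain m a l b where pq: "p = (m, a)" "q = (l, b)" "m \<in> ?J" "l \<in> ?J"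
        by auto
      show "block_toeplitz r q p = qcnj (block_toeplitz r p q)"
        unfolding pq(1,2) block_toeplitz_def case_prod_conv quat_eq_cparts
        \<comment> \<open>The upper block row suffices: its two blocks carry both complex
          components.\<close>
        using C[OF pq(3,4), of "Inl b" "Inl a"] C[OF pq(3,4), of "Inl b" "Inr a"] by simp
    qed
  qed
  let ?S = "\<lambda>v. \<Sum>p\<in>?J \<times> UNIV. \<Sum>q\<in>?J \<times> UNIV. qcnj (v p) * block_toeplitz r p q * v q"
  have S: "cpart2 (?S v) = 0" if H: ?H for v
  proof -
    have qcnj_mult: "qcnj (x * y) = qcnj y * qcnj x" for x y
      by (simp add: quat_eq_cparts cpart1_mult cpart2_mult algebra_simps)
    have qcnj_qcnj: "qcnj (qcnj x) = x" for x
      by (simp add: quat_eq_cparts)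
    have qcnj_sum: "qcnj (\<Sum>x\<in>X. f x) = (\<Sum>x\<in>X. qcnj (f x))" for X and f :: "nat \<times> 's \<Rightarrow> quat"
      by (simp add: quat_eq_cparts cpart1_sum cpart2_sum sum_negf)
    have "qcnj (?S v) = (\<Sum>p\<in>?J \<times> UNIV. \<Sum>q\<in>?J \<times> UNIV. qcnj (v q) * block_toeplitz r q p * v p)"
      unfolding qcnj_sum
    proof (intro sum.cong refl)
      fix p q assume "p \<in> ?J \<times> (UNIV :: 's set)" "q \<in> ?J \<times> (UNIV :: 's set)"
      then have "block_toeplitz r q p = qcnj (block_toeplitz r p q)"
        by (rule bspec[OF bspec[OF H]])
      then show "qcnj (qcnj (v p) * block_toeplitz r p q * v q) = qcnj (v q) * block_toeplitz r q p * v p"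
        by (simp only: qcnj_mult qcnj_qcnj mult.assoc)
    qed
    also have "\<dots> = ?S v"
      by (rule sum.swap)
    finally have "- cpart2 (?S v) = cpart2 (?S v)"
      unfolding quat_eq_cparts cparts_arith(6) by simp
    then show ?thesis
      by simp
  qed
  show "hermitian_psd qcnj (?J \<times> UNIV) (block_toeplitz r) = hermitian_psd cnj (?J \<times> UNIV) (block_toeplitz ?C)"
    unfolding hermitian_psd_def herm[symmetric]
  proof (intro conj_cong refl)
    assume H: ?H
    have "(\<forall>v. ?S v \<in> \<real>\<^sub>\<ge>\<^sub>0) \<longleftrightarrow> (\<forall>v. cpart1 (?S v) \<in> \<real>\<^sub>\<ge>\<^sub>0)"
      using S[OF H] by (simp only: quat_nonneg_Reals_iff simp_thms)
    also have "\<dots> \<longleftrightarrow> (\<forall>v. (\<Sum>p\<in>?J \<times> UNIV. \<Sum>q\<in>?J \<times> UNIV.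
        cnj (complex_column v p) * block_toeplitz ?C p q * complex_column v q) \<in> \<real>\<^sub>\<ge>\<^sub>0)"
      unfolding cpart1_quad_form ..
    also have "\<dots> \<longleftrightarrow> (\<forall>u. (\<Sum>p\<in>?J \<times> UNIV. \<Sum>q\<in>?J \<times> UNIV. cnj (u p) * block_toeplitz ?C p q * u q) \<in> \<real>\<^sub>\<ge>\<^sub>0)"
      by (rule all_complex_column[where P = "\<lambda>u. (\<Sum>p\<in>?J \<times> UNIV. \<Sum>q\<in>?J \<times> UNIV.
          cnj (u p) * block_toeplitz ?C p q * u q) \<in> \<real>\<^sub>\<ge>\<^sub>0"])
    finally show "(\<forall>v. ?S v \<in> \<real>\<^sub>\<ge>\<^sub>0) \<longleftrightarrow>
      (\<forall>u. (\<Sum>p\<in>?J \<times> UNIV. \<Sum>q\<in>?J \<times> UNIV. cnj (u p) * block_toeplitz ?C p q * u q) \<in> \<real>\<^sub>\<ge>\<^sub>0)" .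
  qed
qed

section \<open>Reflection of the circle\<close>

lemma circle_reflect_circle: "t \<in> space circle \<Longrightarrow> circle_reflect t \<in> space circle"
  and circle_reflect_involution: "t \<in> space circle \<Longrightarrow> circle_reflect (circle_reflect t) = t"
  by (auto simp: circle_reflect_def space_circle)

lemma measurable_circle_reflect: "circle_reflect \<in> measurable circle circle"
proof -
  have "circle_reflect \<in> measurable borel borel"
    unfolding circle_reflect_def[abs_def] by measurable
  then have "circle_reflect \<in> borel_measurable circle"
    by (rule measurable_circleI)
  then show ?thesis
    using circle_reflect_circle unfolding space_circle
    by (subst (2) circle_def) (intro measurable_restrict_space2, auto simp: space_circle)
qed

text \<open>\<open>reflected\<close> is defined by an image; since the reflection is an involution,
  the image is a preimage and thus measurable.\<close>

lemma circle_reflect_image: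
  assumes "A \<in> sets circle"
  shows "circle_reflect ` A = circle_reflect -` A \<inter> space circle" "circle_reflect ` A \<in> sets circle"
proof -
  show *: "circle_reflect ` A = circle_reflect -` A \<inter> space circle"
  proof (intro equalityI subsetI)
    fix t assume "t \<in> circle_reflect ` A"
    then show "t \<in> circle_reflect -` A \<inter> space circle"
      using sets.sets_into_space[OF assms] circle_reflect_circle circle_reflect_involution by fastforce
  next
    fix t assume "t \<in> circle_reflect -` A \<inter> space circle"
    then show "t \<in> circle_reflect ` A"
      using circle_reflect_involution[of t] by (intro image_eqI[of _ _ "circle_reflect t"]) auto
  qed
  show "circle_reflect ` A \<in> sets circle"
    unfolding * using measurable_circle_reflect assms by (rule measurable_sets)
qed

text \<open>Reflection negates the frequency and conjugation negates it back. At the fixed point 0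
  every mode is 1.\<close>

lemma mode_circle_reflect: "cnj (mode n (circle_reflect t)) = mode n t"
proof -
  have "mode k (2 * pi - t) = cis (2 * pi * of_int k) / cis (of_int k * t)" for k
    unfolding mode_eq_cis cis_divide by (simp add: algebra_simps)
  then have "mode k (2 * pi - t) = mode (- k) t" for k
    by (simp add: cis_multiple_2pi mode_eq_cis inverse_eq_divide[symmetric])
  moreover have "mode k 0 = 1" for k
    by (simp add: mode_def)
  ultimately show ?thesis
    by (simp add: circle_reflect_def cnj_mode)
qed

text \<open>\<open>J\<close> integrates against \<open>s\<close> times the conjugate of the
  reflected entry. On modes the reflection cancels the inner conjugation, so only the outer one
  remains.\<close>

lemma reflected_functional:
  fixes \<mu> :: "real set \<Rightarrow> complex^'m^'m"
  assumes "positive_matrix_measure \<mu>"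
  defines "I p q \<equiv> complex_measure_integral circle (\<lambda>A. \<mu> A $ p $ q)"
  defines "J s p q f \<equiv> s * cnj (I p q (\<lambda>t. cnj (f (circle_reflect t))))"
  shows "sigma_functional circle (J s p q)" "J s p q (mode n) = s * cnj (I p q (mode n))"
    "A \<in> sets circle \<Longrightarrow> J s p q (indicator A) = s * cnj (\<mu> (circle_reflect ` A) $ p $ q)"
proof -
  note I = positive_matrix_measure_entry[OF assms(1), folded I_def]
  show "sigma_functional circle (J s p q)"
    unfolding J_def by (intro sigma_functional_scale sigma_functional_cnj I measurable_circle_reflect)
  show "J s p q (mode n) = s * cnj (I p q (mode n))"
    unfolding J_def mode_circle_reflect by (rule refl)
  assume A: "A \<in> sets circle"
  have "I p q (indicator (circle_reflect ` A)) = I p q (\<lambda>t. cnj (indicator A (circle_reflect t)))"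
    using circle_reflect_image[OF A]
    by (intro sigma_functional_cong[OF I(1)] bounded_measurable_indicator) (auto simp: indicator_def)
  then show "J s p q (indicator A) = s * cnj (\<mu> (circle_reflect ` A) $ p $ q)"
    unfolding J_def using circle_reflect_image(2)[OF A] by (simp add: I(2)[symmetric])
qed

text \<open>Two functionals agree on indicators iff they agree on modes. The diagonal blocks use
  \<open>s = 1\<close>, the off-diagonal ones \<open>s = -1\<close>.\<close>

lemma fourier_coeffs_reflected:
  fixes \<mu> :: "real set \<Rightarrow> complex^'m^'m"
  assumes pos: "positive_matrix_measure \<mu>"
  shows "(\<forall>A\<in>sets circle. \<mu> A $ p' $ q' = s * cnj (\<mu> (circle_reflect ` A) $ p $ q)) \<longleftrightarrow>
    (\<forall>n. complex_measure_integral circle (\<lambda>A. \<mu> A $ p' $ q') (mode n) =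
      s * cnj (complex_measure_integral circle (\<lambda>A. \<mu> A $ p $ q) (mode n)))"
proof -
  note I = positive_matrix_measure_entry[OF pos, where p = p' and q = q']
  note J = reflected_functional[OF pos, where s = s and p = p and q = q]
  show ?thesis
  proof (intro iffI ballI allI)
    fix n assume *: "\<forall>A\<in>sets circle. \<mu> A $ p' $ q' = s * cnj (\<mu> (circle_reflect ` A) $ p $ q)"
    show "complex_measure_integral circle (\<lambda>A. \<mu> A $ p' $ q') (mode n) =
      s * cnj (complex_measure_integral circle (\<lambda>A. \<mu> A $ p $ q) (mode n))"
      unfolding J(2)[symmetric]
      by (rule sigma_functional_eqI[OF I(1) J(1)]) (simp_all add: I(2) J(3) *[rule_format])
  next
    fix A
    assume *: "\<forall>n. complex_measure_integral circle (\<lambda>A. \<mu> A $ p' $ q') (mode n) =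
      s * cnj (complex_measure_integral circle (\<lambda>A. \<mu> A $ p $ q) (mode n))" and A: "A \<in> sets circle"
    show "\<mu> A $ p' $ q' = s * cnj (\<mu> (circle_reflect ` A) $ p $ q)"
      unfolding J(3)[OF A, symmetric] I(2)[OF A, symmetric]
      by (rule sigma_functional_mode_eqI[OF I(1) J(1) _ bounded_measurable_indicator[OF A]])
        (simp only: J(2) *[rule_format])
  qed
qed

section \<open>q-positive measures\<close>

lemma reflected_apply: "A \<in> sets circle \<Longrightarrow> reflected \<nu> A = \<nu> (circle_reflect ` A)"
  by (simp add: reflected_def)

lemma associated_measure_simps:
  "associated_measure \<nu> A $ Inl a $ Inl b = cpart1 (\<nu> A $ a $ b)"
  "associated_measure \<nu> A $ Inl a $ Inr b = cpart2 (\<nu> A $ a $ b)"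
  "associated_measure \<nu> A $ Inr a $ Inl b = cnj (cpart2 (\<nu> A $ b $ a))"
  "associated_measure \<nu> A $ Inr a $ Inr b = reflected (\<lambda>A. mat_cnj (mat_cpart1 (\<nu> A))) A $ a $ b"
  by (simp_all add: associated_measure_def)

text \<open>The upper block row already contains both complex components.\<close>

lemma associated_measure_inject:
  assumes "associated_measure \<nu> = associated_measure \<nu>'"
  shows "\<nu> = \<nu>'"
proof
  fix A
  have "associated_measure \<nu> A $ Inl a $ x = associated_measure \<nu>' A $ Inl a $ x" for a x
    by (simp add: assms)
  from this[of _ "Inl _"] this[of _ "Inr _"] show "\<nu> A = \<nu>' A"
    by (simp add: associated_measure_simps vec_eq_iff quat_eq_cparts)
qed

lemma quat_measure_integral_cparts:
  "cpart1 (quat_measure_integral \<nu> f $ a $ b) = complex_measure_integral circle (\<lambda>A. cpart1 (\<nu> A $ a $ b)) f"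
  "cpart2 (quat_measure_integral \<nu> f $ a $ b) = complex_measure_integral circle (\<lambda>A. cpart2 (\<nu> A $ a $ b)) f"
  by (simp_all add: quat_measure_integral_def)

text \<open>The upper row is the definition of the integral. The lower right block is conjugate
  because \<open>\<nu>3\<close> is the reflected conjugate of \<open>\<nu>1\<close>, and the
  symmetry of \<open>\<nu>2\<close> turns the adjoint in the lower left into minus a reflected
  conjugate.\<close>

lemma q_positive_fourier_coeffs:
  assumes "q_positive \<nu>" and r: "\<And>n. r n = quat_measure_integral \<nu> (mode n)"
  shows "fourier_coeffs (associated_measure \<nu>) (\<lambda>n. complexify (r n))"
proof -
  have pos: "positive_matrix_measure (associated_measure \<nu>)"
    and sym: "\<And>A. A \<in> sets circle \<Longrightarrow>
      mat_cpart2 (\<nu> A) = - transpose (reflected (\<lambda>A. mat_cpart2 (\<nu> A)) A)"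
    using assms(1) by (auto simp: q_positive_def)
  let ?\<mu> = "associated_measure \<nu>"
  let ?I = "\<lambda>p q. complex_measure_integral circle (\<lambda>A. ?\<mu> A $ p $ q)"
  have ll: "?I (Inl a) (Inl b) (mode n) = cpart1 (r n $ a $ b)"
    and lr: "?I (Inl a) (Inr b) (mode n) = cpart2 (r n $ a $ b)" for a b n
    by (simp_all add: r quat_measure_integral_cparts associated_measure_simps)
  have "\<forall>A\<in>sets circle. ?\<mu> A $ Inr a $ Inr b = 1 * cnj (?\<mu> (circle_reflect ` A) $ Inl a $ Inl b)" for a b
    by (simp add: associated_measure_simps reflected_apply)
  then have rr: "?I (Inr a) (Inr b) (mode n) = 1 * cnj (?I (Inl a) (Inl b) (mode n))" for a b n
    unfolding fourier_coeffs_reflected[OF pos] by blast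
  have "\<forall>A\<in>sets circle. ?\<mu> A $ Inr a $ Inl b = - 1 * cnj (?\<mu> (circle_reflect ` A) $ Inl a $ Inr b)" for a b
  proof
    fix A assume A: "A \<in> sets circle"
    have "cpart2 (\<nu> A $ b $ a) = - cpart2 (\<nu> (circle_reflect ` A) $ a $ b)"
      using arg_cong[OF sym[OF A], of "\<lambda>P. P $ b $ a"] A by (simp add: reflected_apply transpose_def)
    then show "?\<mu> A $ Inr a $ Inl b = - 1 * cnj (?\<mu> (circle_reflect ` A) $ Inl a $ Inr b)"
      by (simp add: associated_measure_simps)
  qed
  then have rl: "?I (Inr a) (Inl b) (mode n) = - 1 * cnj (?I (Inl a) (Inr b) (mode n))" for a b n
    unfolding fourier_coeffs_reflected[OF pos] by blast
  show ?thesis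
    unfolding fourier_coeffs_def
  proof (intro allI)
    fix n p q
    show "?I p q (mode n) = complexify (r n) $ p $ q"
      by (cases p; cases q) (simp_all add: ll lr rl rr)
  qed
qed

lemma bounded_linear_quat_of_complex: "bounded_linear quat_of_complex"
  and bounded_linear_quat_of_complex_j: "bounded_linear (\<lambda>w. quat_of_complex w * quat_j)"
  by (intro bounded_linear_intro[where K = 1];
      simp add: quat_eq_iff quat_of_complex_def quat_j_def plus_quat_def times_quat_def
        scaleR_quat_def norm_quat_def cmod_def)+

text \<open>\<open>\<nu>\<close> is read off from the upper block row of \<open>\<mu>\<close>. The
  relations between the blocks of \<open>complexify\<close> pass to \<open>\<mu>\<close> by
  uniqueness and, with Hermitian symmetry, give back the lower row and the symmetry of
  \<open>\<nu>2\<close>.\<close>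

lemma fourier_coeffs_q_positive:
  fixes r :: "int \<Rightarrow> quat^'s^'s"
  assumes pos: "positive_matrix_measure \<mu>" and coeffs: "fourier_coeffs \<mu> (\<lambda>n. complexify (r n))"
  obtains \<nu> where "q_positive \<nu>" "\<And>n. r n = quat_measure_integral \<nu> (mode n)"
proof -
  define \<nu> :: "real set \<Rightarrow> quat^'s^'s" where
    "\<nu> A = (\<chi> a b. quat_of_complex (\<mu> A $ Inl a $ Inl b) + quat_of_complex (\<mu> A $ Inl a $ Inr b) * quat_j)" for A
  have \<nu>: "cpart1 (\<nu> A $ a $ b) = \<mu> A $ Inl a $ Inl b" "cpart2 (\<nu> A $ a $ b) = \<mu> A $ Inl a $ Inr b" for A a b
    by (simp_all add: \<nu>_def)
  have \<mu>: "vector_measure circle \<mu>"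
    using pos by (simp add: positive_matrix_measure_def)
  have refl: "\<mu> A $ p' $ q' = s * cnj (\<mu> (circle_reflect ` A) $ p $ q)"
    if "A \<in> sets circle" "\<And>n. complexify (r n) $ p' $ q' = s * cnj (complexify (r n) $ p $ q)" for A p q p' q' s
    using fourier_coeffs_reflected[OF pos, of p' q' s p q] coeffs that by (simp add: fourier_coeffs_def)
  have zero: "\<nu> A = 0" if "A \<notin> sets circle" for A
    using vector_measure_notin[OF \<mu> that] by (simp add: vec_eq_iff quat_eq_cparts \<nu>)
  have meas: "vector_measure circle \<nu>"
    unfolding vector_measure_def
  proof (intro conjI allI impI)
    fix F :: "nat \<Rightarrow> real set" assume "range F \<subseteq> sets circle" "disjoint_family F"
    then have "(\<lambda>n. \<mu> (F n)) sums \<mu> (\<Union>n. F n)"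
      by (rule vector_measure_sums[OF \<mu>])
    then have "(\<lambda>n. \<mu> (F n) $ p $ q) sums (\<mu> (\<Union>n. F n) $ p $ q)" for p q
      by (intro bounded_linear.sums[OF bounded_linear_vec_nth])
    then have "(\<lambda>n. \<nu> (F n) $ a $ b) sums (\<nu> (\<Union>n. F n) $ a $ b)" for a b
      unfolding \<nu>_def vec_lambda_beta
      by (intro sums_add bounded_linear.sums[OF bounded_linear_quat_of_complex]
          bounded_linear.sums[OF bounded_linear_quat_of_complex_j])
    then show "(\<lambda>n. \<nu> (F n)) sums \<nu> (\<Union>n. F n)"
      by (intro sums_vecI)
  qed (rule zero)
  have assoc: "associated_measure \<nu> = \<mu>"
  proof
    fix A
    show "associated_measure \<nu> A = \<mu> A"
    proof (cases "A \<in> sets circle")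
      case True
      have "associated_measure \<nu> A $ p $ q = \<mu> A $ p $ q" for p q
      proof (cases p; cases q)
        fix a b assume "p = Inr a" "q = Inr b"
        then show ?thesis
          using refl[OF True, of "Inr a" "Inr b" 1 "Inl a" "Inl b"]
          by (simp add: associated_measure_simps reflected_apply True \<nu>)
      qed (simp_all add: associated_measure_simps \<nu> positive_matrix_measure_hermitian[OF pos True])
      then show ?thesis
        by (simp add: vec_eq_iff)
    next
      case False
      have "associated_measure \<nu> A $ p $ q = 0" for p q
        by (cases p; cases q) (simp_all add: associated_measure_simps zero[OF False] reflected_def False)
      then show ?thesis
        by (simp add: vec_eq_iff positive_matrix_measure_notin[OF pos False])
    qed
  qed
  have "mat_cpart2 (\<nu> A) = - transpose (reflected (\<lambda>A. mat_cpart2 (\<nu> A)) A)" if A: "A \<in> sets circle" for A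
  proof -
    have "\<mu> A $ Inl a $ Inr b = - \<mu> (circle_reflect ` A) $ Inl b $ Inr a" for a b
      \<comment> \<open>The coefficients give block 12 as minus the reflected conjugate of block 21;
        Hermitian symmetry turns this into the transpose of block 12.\<close>
      using refl[OF A, of "Inl a" "Inr b" "-1" "Inr a" "Inl b"]
        positive_matrix_measure_hermitian[OF pos circle_reflect_image(2)[OF A]] by simp
    then show ?thesis
      using A by (simp add: vec_eq_iff \<nu> reflected_apply transpose_def)
  qed
  then have "q_positive \<nu>"
    using pos meas by (simp add: q_positive_def assoc)
  moreover have "r n = quat_measure_integral \<nu> (mode n)" for n
    using coeffs by (simp add: vec_eq_iff quat_eq_cparts quat_measure_integral_cparts \<nu> fourier_coeffs_def)
  ultimately show thesis
    by (rule that)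
qed

theorem theorem5p5:
  fixes r :: "int \<Rightarrow> quat^'s^'s"
  shows "positive_definite r \<longleftrightarrow>
    (\<exists>!\<nu>. q_positive \<nu> \<and>
      (\<forall>n. r n = quat_measure_integral \<nu>
                 (\<lambda>t. exp (\<i> * of_int n * complex_of_real t))))"
proof -
  have mode: "(\<lambda>t. exp (\<i> * of_int n * complex_of_real t)) = mode n" for n
    by (simp add: mode_def fun_eq_iff)
  have pos: "positive_matrix_measure (associated_measure \<nu>)" if "q_positive \<nu>" for \<nu> :: "real set \<Rightarrow> quat^'s^'s"
    using that by (simp add: q_positive_def)
  show ?thesis
    unfolding mode
  proof
    assume "positive_definite r"
    then obtain \<mu> where "positive_matrix_measure \<mu>" "fourier_coeffs \<mu> (\<lambda>n. complexify (r n))"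
      using fourier_coeffs_exist[of "\<lambda>n. complexify (r n)"] by (auto simp: positive_definite_iff_complexify)
    then obtain \<nu> where \<nu>: "q_positive \<nu>" "\<And>n. r n = quat_measure_integral \<nu> (mode n)"
      by (rule fourier_coeffs_q_positive) blast
    show "\<exists>!\<nu>. q_positive \<nu> \<and> (\<forall>n. r n = quat_measure_integral \<nu> (mode n))"
    proof (rule ex1I[of _ \<nu>])
      show "q_positive \<nu> \<and> (\<forall>n. r n = quat_measure_integral \<nu> (mode n))"
        using \<nu> by blast
      fix \<nu>' assume "q_positive \<nu>' \<and> (\<forall>n. r n = quat_measure_integral \<nu>' (mode n))"
      \<comment> \<open>Both associated measures have the coefficients
        \<open>complexify (r n)\<close>, so they coincide, and each determines its quaternionic
        measure.\<close>
      then show "\<nu>' = \<nu>"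
        using \<nu> by (intro associated_measure_inject positive_matrix_measure_unique[OF pos pos
              q_positive_fourier_coeffs q_positive_fourier_coeffs, of _ _ r]) auto
    qed
  next
    assume "\<exists>!\<nu>. q_positive \<nu> \<and> (\<forall>n. r n = quat_measure_integral \<nu> (mode n))"
    then obtain \<nu> where \<nu>: "q_positive \<nu>" "\<And>n. r n = quat_measure_integral \<nu> (mode n)"
      by blast
    then show "positive_definite r"
      unfolding positive_definite_iff_complexify
      using fourier_coeffs_positive[OF pos q_positive_fourier_coeffs] by blast
  qed
qed

end
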